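(* Let $C \subseteq (0,\infty)$ be a set condensating to $\infty$, and let $f\colon \mathbb{R}^2 \to \mathbb{R}$ be a continuous function. Then $f$ is horizontally rigid for $C$ if and only if there exist $a,b,d \in \mathbb{R}$ such that $f(x,y) = a + bx + dy$ for all $(x,y) \in \mathbb{R}^2$.
   Context: For a function $f\colon \mathbb{R}^n \to \mathbb{R}$, $\operatorname{graph}(f) = \{(\vec{x}, f(\vec{x})) : \vec{x} \in \mathbb{R}^n\} \subseteq \mathbb{R}^{n+1}$, and for $c \in (0,\infty)$, $f(c\,\cdot)$ denotes the function $\vec{x} \mapsto f(c\vec{x})$. For a set $C \subseteq (0,\infty)$, a function $f\colon \mathbb{R}^n \to \mathbb{R}$ is called horizontally rigid for $C$ if for every $c \in C$ there exists an isometry $\varphi$ of $\mathbb{R}^{n+1}$ (with the Euclidean metric) such that $\varphi(\operatorname{graph}(f)) = \operatorname{graph}(f(c\,\cdot))$. A set $C \subseteq (0,\infty)$ is said to condensate to $\infty$ if for every $r \in \mathbb{R}$ the set $C \cap (r,\infty)$ is uncountable. *)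

theory Defs
  imports "HOL-Analysis.Analysis"
begin

text \<open>The space \<open>\<real>\<^sup>n\<^sup>+\<^sup>1\<close> is represented as the product \<open>\<real>\<^sup>n \<times> \<real>\<close>. The library's metric on a
  product is \<open>dist (x, s) (y, t) = sqrt ((dist x y)\<^sup>2 + (dist s t)\<^sup>2)\<close>, that is, the Euclidean one.\<close>

definition graph_of :: "(real ^ 'n \<Rightarrow> real) \<Rightarrow> ((real ^ 'n) \<times> real) set" where
  "graph_of f = {(x, f x) |x. True}"

definition isometry :: "('a::metric_space \<Rightarrow> 'a) \<Rightarrow> bool" where
  "isometry \<phi> \<longleftrightarrow> bij \<phi> \<and> (\<forall>p q. dist (\<phi> p) (\<phi> q) = dist p q)"

definition horizontally_rigid :: "(real ^ 'n \<Rightarrow> real) \<Rightarrow> real set \<Rightarrow> bool" where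
  "horizontally_rigid f C \<longleftrightarrow>
     (\<forall>c\<in>C. \<exists>\<phi> :: (real ^ 'n) \<times> real \<Rightarrow> (real ^ 'n) \<times> real.
        isometry \<phi> \<and> \<phi> ` graph_of f = graph_of (\<lambda>x. f (c *\<^sub>R x)))"

definition condensates_to_infinity :: "real set \<Rightarrow> bool" where
  "condensates_to_infinity C \<longleftrightarrow> (\<forall>r. uncountable (C \<inter> {r<..}))"

end

theory Submission
  imports Defs
begin

text \<open>For \<open>c \<in> C\<close> let \<open>D c (x, t) = (c x, t)\<close>. Since \<open>D c\<close> maps the graph of \<open>f(c \<cdot>)\<close> to the graph of
  \<open>f\<close>, rigidity provides, for a sequence of \<open>c \<in> C\<close> tending to infinity, affine maps with linear part
  \<open>L = D c \<circ> A\<close>, with \<open>A\<close> orthogonal, that preserve the graph. They preserve up to sign the recession cone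
  \<open>K\<close> of the epigraph of \<open>f\<close>, a closed convex cone containing \<open>e = (0, 1)\<close> but not \<open>-e\<close>, whose lineality
  space \<open>V = K \<inter> -K\<close> consists of the translations preserving the graph. Two of the lines \<open>A\<^sup>-\<^sup>1 e\<close>
  can coincide only if \<open>f\<close> is constant.

  If \<open>V\<close> is a plane then \<open>f\<close> is affine. If \<open>V\<close> is horizontal, cut \<open>K\<close> down to the pointed cone
  \<open>K \<inter> V\<^sup>\<bottom>\<close>; letting \<open>c\<close> tend to infinity shows that this cone has a face of codimension one
  in the horizontal hyperplane, so that its preimages under the maps \<open>L\<close> are infinitely many congruent
  faces, which is impossible. If \<open>V\<close> is a slanted line, then \<open>f\<close> is, up to a linear term, a function
  \<open>g\<close> of one variable, and \<open>K / V\<close> is a planar pointed cone preserved by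
  rotations followed by stretchings \<open>diag(c, m)\<close>, where \<open>m < c\<close> and \<open>m / c\<close> stays away from \<open>0\<close>. Since the
  ratios \<open>m / c\<close> differ, the rotations must permute the axes, so that \<open>g\<close> is homogeneous
  with exponent \<open>log m / log c\<close>, which is therefore independent of \<open>c\<close>. But it is less than \<open>1\<close> and
  tends to \<open>1\<close>.\<close>

section \<open>The recession cone of the epigraph\<close>

text \<open>The directions along which the epigraph of \<open>f\<close> can be pushed forever. As
  \<open>f\<close> need not be convex, the inequality is demanded at every base point
  \<open>x\<close>; this makes the set closed under addition.\<close>

definition rec_cone :: "('a::real_normed_vector \<Rightarrow> real) \<Rightarrow> ('a \<times> real) set" where
  "rec_cone f = {v. \<forall>x. \<forall>t\<ge>0. f (x + t *\<^sub>R fst v) \<le> f x + t * snd v}"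

lemma rec_cone_add:
  assumes "v \<in> rec_cone f" "w \<in> rec_cone f"
  shows "v + w \<in> rec_cone f"
  unfolding rec_cone_def
proof (intro CollectI allI impI)
  fix x and t :: real assume "0 \<le> t"
  then have "f ((x + t *\<^sub>R fst v) + t *\<^sub>R fst w) \<le> f (x + t *\<^sub>R fst v) + t * snd w"
       "f (x + t *\<^sub>R fst v) \<le> f x + t * snd v"
    using assms by (auto simp: rec_cone_def)
  then show "f (x + t *\<^sub>R fst (v + w)) \<le> f x + t * snd (v + w)"
    by (simp add: algebra_simps)
qed

lemma rec_cone_scaleR:
  assumes "v \<in> rec_cone f" "r \<ge> 0"
  shows "r *\<^sub>R v \<in> rec_cone f"
  unfolding rec_cone_def
proof (intro CollectI allI impI)
  fix x and t :: real assume "0 \<le> t"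
  then have "0 \<le> t * r" using assms by simp
  then have "f (x + (t * r) *\<^sub>R fst v) \<le> f x + (t * r) * snd v"
    using assms unfolding rec_cone_def by blast
  then show "f (x + t *\<^sub>R fst (r *\<^sub>R v)) \<le> f x + t * snd (r *\<^sub>R v)"
    by (simp add: mult.assoc)
qed

lemma vertical_in_rec_cone: "(0, 1) \<in> rec_cone f"
  by (simp add: rec_cone_def)

lemma convex_cone_rec_cone: "convex_cone (rec_cone f)"
proof -
  have "0 \<in> rec_cone f"
    using rec_cone_scaleR[OF vertical_in_rec_cone[of f], of 0] by (simp add: zero_prod_def)
  then show ?thesis
    by (auto simp: convex_cone_iff rec_cone_add rec_cone_scaleR)
qed

lemma closed_rec_cone:
  fixes f :: "'a::real_normed_vector \<Rightarrow> real"
  assumes "continuous_on UNIV f"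
  shows "closed (rec_cone f)"
proof -
  have "rec_cone f = (\<Inter>x. \<Inter>t\<in>{0..}. {v. f (x + t *\<^sub>R fst v) \<le> f x + t * snd v})"
    by (auto simp: rec_cone_def)
  moreover have "closed {v. f (x + t *\<^sub>R fst v) \<le> f x + t * snd v}" for x t
    by (intro closed_Collect_le continuous_intros continuous_on_compose2[OF assms]) auto
  ultimately show ?thesis by (auto intro!: closed_INT)
qed

text \<open>Going from \<open>x\<close> along \<open>v\<close> bounds the increment above; returning
  along \<open>- v\<close> bounds it below. Negative \<open>t\<close> is handled by swapping
  \<open>v\<close> and \<open>- v\<close>.\<close>

lemma rec_cone_lineality:
  assumes "v \<in> rec_cone f" "- v \<in> rec_cone f"
  shows "f (x + t *\<^sub>R fst v) = f x + t * snd v"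
proof -
  have *: "f (x + t *\<^sub>R fst v) = f x + t * snd v"
    if "v \<in> rec_cone f" "- v \<in> rec_cone f" "t \<ge> 0" for x t v
  proof -
    have "f (x + t *\<^sub>R fst v) \<le> f x + t * snd v"
      using that by (auto simp: rec_cone_def)
    moreover have "f ((x + t *\<^sub>R fst v) + t *\<^sub>R fst (- v)) \<le> f (x + t *\<^sub>R fst v) + t * snd (- v)"
      using that unfolding rec_cone_def by blast
    ultimately show ?thesis by simp
  qed
  show ?thesis
  proof (cases "t \<ge> 0")
    case True then show ?thesis using * assms by blast
  next
    case False
    then have "f (x + (-t) *\<^sub>R fst (-v)) = f x + (-t) * snd (-v)"
      using *[of "-v" "-t" x] assms by simp
    then show ?thesis by simp
  qed
qed

text \<open>The strict epigraph is a component of the complement of the graph, which a homeomorphism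
  preserving the graph can move. Points at height \<open>f x + e\<close> recover the weak inequality
  for small \<open>e\<close>.\<close>

lemma rec_cone_iff_above:
  "v \<in> rec_cone f \<longleftrightarrow> (\<forall>p t. t \<ge> 0 \<longrightarrow> f (fst p) < snd p \<longrightarrow> f (fst (p + t *\<^sub>R v)) < snd (p + t *\<^sub>R v))"
    (is "_ \<longleftrightarrow> ?R")
proof
  assume "v \<in> rec_cone f"
  then show ?R by (fastforce simp: rec_cone_def intro: le_less_trans)
next
  assume R: ?R
  show "v \<in> rec_cone f" unfolding rec_cone_def
  proof (intro CollectI allI impI)
    fix x and t :: real assume t: "0 \<le> t"
    show "f (x + t *\<^sub>R fst v) \<le> f x + t * snd v"
    proof (rule field_le_epsilon)
      fix e :: real assume "e > 0"
      then show "f (x + t *\<^sub>R fst v) \<le> f x + t * snd v + e"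
        using R[rule_format, OF t, of "(x, f x + e)"] by simp
    qed
  qed
qed

text \<open>For maps exchanging the two sides of the graph, the cone must also be read off from the
  lower side, which is stable under moving backwards.\<close>

lemma rec_cone_iff_below:
  "v \<in> rec_cone f \<longleftrightarrow> (\<forall>p t. t \<ge> 0 \<longrightarrow> snd p < f (fst p) \<longrightarrow> snd (p - t *\<^sub>R v) < f (fst (p - t *\<^sub>R v)))"
    (is "_ \<longleftrightarrow> ?R")
proof
  assume v: "v \<in> rec_cone f"
  show ?R
  proof (intro allI impI)
    fix p and t :: real assume t: "t \<ge> 0" "snd p < f (fst p)"
    then have "f ((fst p - t *\<^sub>R fst v) + t *\<^sub>R fst v) \<le> f (fst p - t *\<^sub>R fst v) + t * snd v"
      using v unfolding rec_cone_def by blast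
    then show "snd (p - t *\<^sub>R v) < f (fst (p - t *\<^sub>R v))" using t by simp
  qed
next
  assume R: ?R
  show "v \<in> rec_cone f" unfolding rec_cone_def
  proof (intro CollectI allI impI)
    fix x and t :: real assume t: "0 \<le> t"
    show "f (x + t *\<^sub>R fst v) \<le> f x + t * snd v"
    proof (rule field_le_epsilon)
      fix e :: real assume "e > 0"
      then show "f (x + t *\<^sub>R fst v) \<le> f x + t * snd v + e"
        using R[rule_format, OF t, of "(x + t *\<^sub>R fst v, f (x + t *\<^sub>R fst v) - e)"] by simp
    qed
  qed
qed

text \<open>The shear taking \<open>(x, t)\<close> to \<open>(x, f x + t)\<close> carries the open
  half-spaces onto these sets.\<close>

lemma connected_above_below:
  fixes f :: "'a::real_normed_vector \<Rightarrow> real"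
  assumes "continuous_on UNIV f"
  shows "connected {p. f (fst p) < snd p}" "connected {p. snd p < f (fst p)}"
proof -
  have c: "connected (UNIV \<times> {0<..} :: ('a \<times> real) set)" "connected (UNIV \<times> {..<0} :: ('a \<times> real) set)"
    by (auto intro!: convex_connected convex_Times)
  have cont: "continuous_on S (\<lambda>p. (fst p, f (fst p) + snd p))" for S :: "('a \<times> real) set"
    by (intro continuous_intros continuous_on_compose2[OF assms]) auto
  have "{p. f (fst p) < snd p} = (\<lambda>p. (fst p, f (fst p) + snd p)) ` (UNIV \<times> {0<..})"
    by (force simp: image_iff intro: bexI[of _ "b - f a" for a b])
  then show "connected {p. f (fst p) < snd p}"
    using connected_continuous_image[OF cont c(1)] by simp
  have "{p. snd p < f (fst p)} = (\<lambda>p. (fst p, f (fst p) + snd p)) ` (UNIV \<times> {..<0})"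
    by (force simp: image_iff intro: bexI[of _ "b - f a" for a b])
  then show "connected {p. snd p < f (fst p)}"
    using connected_continuous_image[OF cont c(2)] by simp
qed

text \<open>An affine homeomorphism preserving the graph preserves or exchanges the two components of
  its complement.\<close>

lemma rec_cone_affine_invariant:
  fixes f :: "'a::euclidean_space \<Rightarrow> real" and L :: "'a \<times> real \<Rightarrow> 'a \<times> real"
  assumes f: "continuous_on UNIV f" and L: "linear L" "bij L"
    and G: "\<And>p. f (fst (L p + b)) = snd (L p + b) \<longleftrightarrow> f (fst p) = snd p"
  shows "(\<forall>v. L v \<in> rec_cone f \<longleftrightarrow> v \<in> rec_cone f) \<or> (\<forall>v. - L v \<in> rec_cone f \<longleftrightarrow> v \<in> rec_cone f)"
proof -
  define U where "U = {p. f (fst p) < snd p}"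
  define D where "D = {p. snd p < f (fst p)}"
  define F where "F = (\<lambda>p. L p + b)"
  have F: "bij F"
    using bij_comp[OF L(2) bij_plus_right[of b]] unfolding F_def comp_def .
  have Fadd: "F (p + t *\<^sub>R v) = F p + t *\<^sub>R L v" for p t v
    by (simp add: F_def linear_add[OF L(1)] linear_scale[OF L(1)])
  have opn: "open U" "open D"
    unfolding U_def D_def by (intro open_Collect_less continuous_intros continuous_on_compose2[OF f]; auto)+
  have disj: "U \<inter> D = {}" by (auto simp: U_def D_def)
  have conn: "connected U" "connected D"
    unfolding U_def D_def using connected_above_below[OF f] by auto
  have contF: "continuous_on S F" for S
    unfolding F_def by (intro continuous_intros linear_continuous_on L(1)[unfolded linear_conv_bounded_linear])
  have UD: "p \<in> U \<union> D \<longleftrightarrow> f (fst p) \<noteq> snd p" for p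
    by (auto simp: U_def D_def)
  have FUD: "F p \<in> U \<union> D \<longleftrightarrow> p \<in> U \<union> D" for p
    using G[of p] unfolding UD F_def by simp
  \<comment> \<open>A connected set off the graph has a connected image off the graph, which the
    disjoint open sets \<open>U\<close> and \<open>D\<close> cannot split.\<close>
  have dich: "F ` S \<subseteq> U \<or> F ` S \<subseteq> D" if "connected S" "S \<subseteq> U \<union> D" for S
  proof -
    have "connected (F ` S)" by (rule connected_continuous_image[OF contF that(1)])
    moreover have "F ` S \<subseteq> U \<union> D" using FUD that by blast
    ultimately show ?thesis
      using connectedD[OF _ opn, of "F ` S"] disj by blast
  qed
  have surj: "F ` U \<union> F ` D = U \<union> D"
  proof -
    have "\<exists>p\<in>U \<union> D. q = F p" if "q \<in> U \<union> D" for q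
      using that FUD bij_pointE[OF F, of q] by metis
    then show ?thesis using FUD by blast
  qed
  have ne: "(0, f 0 + 1) \<in> U" "(0, f 0 - 1) \<in> D" by (auto simp: U_def D_def)
  \<comment> \<open>Surjectivity rules out that both components land in the same one.\<close>
  have "(F ` U = U \<and> F ` D = D) \<or> (F ` U = D \<and> F ` D = U)"
  proof -
    have "F ` U \<subseteq> U \<or> F ` U \<subseteq> D" "F ` D \<subseteq> U \<or> F ` D \<subseteq> D"
      using dich[OF conn(1)] dich[OF conn(2)] by auto
    moreover have "U \<noteq> {}" "D \<noteq> {}" using ne by auto
    moreover have "(A = U \<and> B = D) \<or> (A = D \<and> B = U)"
      if "A \<union> B = U \<union> D" "U \<inter> D = {}" "U \<noteq> {}" "D \<noteq> {}" "A \<subseteq> U \<or> A \<subseteq> D" "B \<subseteq> U \<or> B \<subseteq> D"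
      for A B :: "('a \<times> real) set" using that by blast
    ultimately show ?thesis using surj disj by presburger
  qed
  then show ?thesis
  proof (elim disjE conjE)
    assume FU: "F ` U = U"
    have "L v \<in> rec_cone f \<longleftrightarrow> v \<in> rec_cone f" for v
    proof -
      have "L v \<in> rec_cone f \<longleftrightarrow> (\<forall>p\<in>F ` U. \<forall>t\<ge>0. p + t *\<^sub>R L v \<in> F ` U)"
        unfolding rec_cone_iff_above FU by (auto simp: U_def)
      also have "\<dots> \<longleftrightarrow> (\<forall>p\<in>U. \<forall>t\<ge>0. p + t *\<^sub>R v \<in> U)"
        by (simp add: Fadd[symmetric] inj_image_mem_iff[OF bij_is_inj[OF F]])
      also have "\<dots> \<longleftrightarrow> v \<in> rec_cone f"
        unfolding rec_cone_iff_above by (auto simp: U_def)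
      finally show ?thesis .
    qed
    then show ?thesis by blast
  next
    assume FU: "F ` U = D"
    \<comment> \<open>The lower side is stable under the negatives of the members of the cone,
      whence the sign.\<close>
    have "- L v \<in> rec_cone f \<longleftrightarrow> v \<in> rec_cone f" for v
    proof -
      have "- L v \<in> rec_cone f \<longleftrightarrow> (\<forall>p\<in>F ` U. \<forall>t\<ge>0. p + t *\<^sub>R L v \<in> F ` U)"
        unfolding rec_cone_iff_below FU by (auto simp: D_def)
      also have "\<dots> \<longleftrightarrow> (\<forall>p\<in>U. \<forall>t\<ge>0. p + t *\<^sub>R v \<in> U)"
        by (simp add: Fadd[symmetric] inj_image_mem_iff[OF bij_is_inj[OF F]])
      also have "\<dots> \<longleftrightarrow> v \<in> rec_cone f"
        unfolding rec_cone_iff_above by (auto simp: U_def)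
      finally show ?thesis .
    qed
    then show ?thesis by blast
  qed
qed

section \<open>Pointed cones invariant under horizontal stretchings of orthogonal maps\<close>

definition horizontal_scaling :: "real \<Rightarrow> 'a::real_normed_vector \<times> real \<Rightarrow> 'a \<times> real" where
  "horizontal_scaling c p = (c *\<^sub>R fst p, snd p)"

lemma linear_horizontal_scaling: "linear (horizontal_scaling c)"
  unfolding horizontal_scaling_def by (intro linearI) (auto simp: algebra_simps)

lemma horizontal_scaling_inverse [simp]:
  "c \<noteq> 0 \<Longrightarrow> horizontal_scaling c (horizontal_scaling (1 / c) p) = p"
  "c \<noteq> 0 \<Longrightarrow> horizontal_scaling (1 / c) (horizontal_scaling c p) = p"
  by (auto simp: horizontal_scaling_def)

lemma inner_horizontal_scaling: "horizontal_scaling c p \<bullet> q = p \<bullet> horizontal_scaling c q"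
  for p q :: "'a::real_inner \<times> real"
  by (simp add: horizontal_scaling_def inner_prod_def)

lemma horizontal_scaling_in_subspace:
  assumes "subspace W" "(0, 1) \<in> W" "p \<in> W"
  shows "horizontal_scaling c p \<in> W"
proof -
  \<comment> \<open>Horizontal stretching is the homothety by \<open>c\<close> corrected along the
    vertical axis.\<close>
  have "horizontal_scaling c p = c *\<^sub>R p + ((1 - c) * snd p) *\<^sub>R (0, 1)"
    by (auto simp: horizontal_scaling_def prod_eq_iff algebra_simps)
  then show ?thesis
    using assms by (metis subspace_add subspace_scale)
qed

text \<open>Division by \<open>c n\<close> undoes the stretching of the horizontal part and makes
  the height vanish in the limit.\<close>

lemma tendsto_horizontal_scaling_inverse:
  fixes A :: "nat \<Rightarrow> 'a::euclidean_space \<times> real"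
  assumes "A \<longlonglongrightarrow> p" "filterlim c at_top sequentially" "\<And>n. c n > 0"
  shows "(\<lambda>n. (1 / c n) *\<^sub>R horizontal_scaling (c n) (A n)) \<longlonglongrightarrow> (fst p, 0)"
proof -
  have "(\<lambda>n. (fst (A n), inverse (c n) * snd (A n))) \<longlonglongrightarrow> (fst p, 0 * snd p)"
    by (intro tendsto_intros assms tendsto_inverse_0_at_top)
  moreover have "(1 / c n) *\<^sub>R horizontal_scaling (c n) (A n) = (fst (A n), inverse (c n) * snd (A n))" for n
    using assms(3)[of n] by (simp add: horizontal_scaling_def prod_eq_iff field_simps)
  ultimately show ?thesis by simp
qed

lemma norm_diff_unit:
  fixes v w :: "'a::real_inner"
  assumes "v \<bullet> v = 1" "w \<bullet> w = 1"
  shows "(norm (w - v))\<^sup>2 = 2 - 2 * (w \<bullet> v)"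
  using assms by (simp add: power2_norm_eq_inner inner_diff_left inner_diff_right inner_commute[of v w])

text \<open>With cosine \<open>w \<bullet> v\<close>, this is the squared sine: the squared distance
  from \<open>w\<close> to the line of \<open>v\<close>.\<close>

lemma norm_projection_unit:
  fixes v w :: "'a::real_inner"
  assumes "v \<bullet> v = 1" "w \<bullet> w = 1"
  shows "(norm ((w \<bullet> v) *\<^sub>R v - w))\<^sup>2 = 1 - (w \<bullet> v)\<^sup>2"
  unfolding power2_norm_eq_inner using assms
  by (simp add: inner_diff_left inner_diff_right inner_commute[of v w] power2_eq_square)

text \<open>If \<open>K\<close> is pointed then it lies above every hyperplane \<open>(B n e)\<^sup>\<bottom>\<close>, where \<open>e = (0, 1)\<close>, and
  touches it in a congruent copy of one face with nonempty relative interior. Two such faces cannot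
  be close to each other.\<close>

lemma no_pointed_invariant_cone_convergent:
  fixes K :: "('a::euclidean_space \<times> real) set"
    and A B :: "nat \<Rightarrow> 'a \<times> real \<Rightarrow> 'a \<times> real"
  assumes K: "closed K" "convex_cone K" "(0, 1) \<in> K"
    and pointed: "\<And>v. v \<in> K \<Longrightarrow> - v \<in> K \<Longrightarrow> v = 0"
    and A: "\<And>n. orthogonal_transformation (A n)" and B: "\<And>n. orthogonal_transformation (B n)"
    and AB: "\<And>n v. A n (B n v) = v" "\<And>n v. B n (A n v) = v"
    and limA: "\<And>v. (\<lambda>n. A n v) \<longlonglongrightarrow> A0 v" and limB: "\<And>v. (\<lambda>n. B n v) \<longlonglongrightarrow> B0 v"
    and c: "\<And>n. c n > 0" "filterlim c at_top sequentially"
    and invariant: "\<And>n v. horizontal_scaling (c n) (A n v) \<in> K \<longleftrightarrow> v \<in> K"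
    and distinct: "\<And>m n. m \<noteq> n \<Longrightarrow> B m (0, 1) \<noteq> B n (0, 1)"
  shows False
proof -
  define e where "e = (0 :: 'a, 1 :: real)"
  define w where "w = (\<lambda>n. B n e)"
  define W where "W = span K"
  note linA = orthogonal_transformation_linear[OF A]
  note linB = orthogonal_transformation_linear[OF B]
  have c0: "c n \<noteq> 0" for n using c(1)[of n] by simp
  have snd_inner: "snd p = p \<bullet> e" for p by (simp add: e_def inner_prod_def)
  have Binner: "B n p \<bullet> B n q = p \<bullet> q" and Ainner: "A n p \<bullet> A n q = p \<bullet> q" for n p q
    using A B by (simp_all add: orthogonal_transformation_def del: split_paired_All)
  have A0_lin: "A0 (p + t *\<^sub>R q) = A0 p + t *\<^sub>R A0 q" for p q t
  proof (rule LIMSEQ_unique[OF limA])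
    have "(\<lambda>n. A n p + t *\<^sub>R A n q) \<longlonglongrightarrow> A0 p + t *\<^sub>R A0 q"
      by (intro tendsto_intros limA)
    then show "(\<lambda>n. A n (p + t *\<^sub>R q)) \<longlonglongrightarrow> A0 p + t *\<^sub>R A0 q"
      by (simp add: linear_add[OF linA] linear_scale[OF linA])
  qed
  have A0B0: "A0 (B0 z) = z" for z
  proof (rule LIMSEQ_unique[OF limA])
    have "norm (A n (B0 z) - z) = norm (B0 z - B n z)" for n
      using orthogonal_transformation_norm[OF A[of n], of "B0 z - B n z"]
      by (simp add: linear_diff[OF linA] AB)
    moreover have "(\<lambda>n. norm (B0 z - B n z)) \<longlonglongrightarrow> norm (B0 z - B0 z)"
      by (intro tendsto_intros limB)
    ultimately have "(\<lambda>n. norm (A n (B0 z) - z)) \<longlonglongrightarrow> 0" by simp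
    then show "(\<lambda>n. A n (B0 z)) \<longlonglongrightarrow> z"
      using Lim_null tendsto_norm_zero_iff by blast
  qed
  have B0_norm: "norm (B0 z) = norm z" for z
  proof (rule LIMSEQ_unique[OF tendsto_norm[OF limB]])
    show "(\<lambda>n. norm (B n z)) \<longlonglongrightarrow> norm z"
      by (simp add: orthogonal_transformation_norm[OF B])
  qed
  have scale: "r *\<^sub>R v \<in> K" if "v \<in> K" "r \<ge> 0" for r v
    using convex_cone_scaleR[OF K(2)] that by blast
  \<comment> \<open>\<open>B n\<close> after shrinking by \<open>c n\<close> is the inverse of the
    \<open>n\<close>-th symmetry, so it too maps \<open>K\<close> into itself.\<close>
  have pull: "B n (horizontal_scaling (1 / c n) v) \<in> K" if "v \<in> K" for n v
    using invariant[of n "B n (horizontal_scaling (1 / c n) v)"] that c0 by (simp add: AB)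
  have wK: "w n \<in> K" for n
    using pull[OF K(3), of n] by (simp add: w_def e_def horizontal_scaling_def)
  \<comment> \<open>Inverse symmetries shrink away the horizontal part of \<open>v\<close>, so its
    images tend to \<open>snd v\<close> times \<open>B0 e\<close>. Were \<open>snd v\<close>
    negative, both \<open>B0 e\<close> and its negative would lie in \<open>K\<close>.\<close>
  have upper: "snd v \<ge> 0" if v: "v \<in> K" for v
  proof (rule ccontr)
    assume neg: "\<not> snd v \<ge> 0"
    have "(\<lambda>n. snd v *\<^sub>R B n e + inverse (c n) *\<^sub>R B n (fst v, 0)) \<longlonglongrightarrow> snd v *\<^sub>R B0 e + 0 *\<^sub>R B0 (fst v, 0)"
      by (intro tendsto_intros limB tendsto_inverse_0_at_top c)
    moreover have "snd v *\<^sub>R B n e + inverse (c n) *\<^sub>R B n (fst v, 0) = B n (horizontal_scaling (1 / c n) v)" for n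
      by (simp add: linear_scale[OF linB, symmetric] linear_add[OF linB, symmetric] horizontal_scaling_def e_def field_simps)
    ultimately have "snd v *\<^sub>R B0 e \<in> K"
      using closed_sequentially[OF K(1), of "\<lambda>n. B n (horizontal_scaling (1 / c n) v)"] pull[OF v] by simp
    then have "(- 1 / snd v) *\<^sub>R snd v *\<^sub>R B0 e \<in> K"
      using neg by (intro scale[of _ "- 1 / snd v"]) (auto simp: divide_nonpos_neg)
    then have "- B0 e \<in> K" using neg by simp
    moreover have "B0 e \<in> K"
      using closed_sequentially[OF K(1), of w "B0 e"] wK limB by (simp add: w_def)
    ultimately have "B0 e = 0" using pointed by blast
    then show False using B0_norm[of e] by (simp add: e_def norm_Pair)
  qed
  \<comment> \<open>The height of \<open>A n v\<close> is its product with \<open>e\<close>, which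
    orthogonality turns into \<open>v \<bullet> w n\<close>.\<close>
  have above: "v \<bullet> w n \<ge> 0" if "v \<in> K" for v n
  proof -
    have "snd (A n v) \<ge> 0"
      using upper[of "horizontal_scaling (c n) (A n v)"] invariant[of n v] that by (simp add: horizontal_scaling_def)
    then have "A n v \<bullet> A n (w n) \<ge> 0"
      by (simp add: w_def AB snd_inner)
    then show ?thesis by (simp add: Ainner)
  qed
  have horizontal: "(fst (A0 v), 0) \<in> K" if v: "v \<in> K" for v
  proof -
    have "(1 / c n) *\<^sub>R horizontal_scaling (c n) (A n v) \<in> K" for n
      using invariant[of n v] v less_imp_le[OF c(1)[of n]] by (intro scale) auto
    then show ?thesis
      using closed_sequentially[OF K(1) _ tendsto_horizontal_scaling_inverse[OF limA[of v] c(2,1)]] by simp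
  qed
  have subW: "subspace W" and eW: "(0, 1) \<in> W" and KW: "K \<subseteq> W"
    unfolding W_def using K(3) span_superset[of K] by auto
  \<comment> \<open>The symmetries and the stretchings preserve the span of \<open>K\<close>, hence
    so do the orthogonal maps. All discs below are taken inside \<open>W\<close>, as
    \<open>K\<close> may have empty interior.\<close>
  have BW: "B n v \<in> W" if v: "v \<in> W" for n v
  proof -
    have lin: "linear (\<lambda>v. B n (horizontal_scaling (1 / c n) v))"
      using linear_compose[OF linear_horizontal_scaling linB[of n]] by (simp add: comp_def)
    have "(\<lambda>v. B n (horizontal_scaling (1 / c n) v)) ` W \<subseteq> W"
      unfolding W_def linear_span_image[OF lin, symmetric] using pull by (intro span_mono) auto
    moreover have "horizontal_scaling (c n) v \<in> W" using horizontal_scaling_in_subspace[OF subW eW v] .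
    ultimately show ?thesis using c0[of n] by (force simp: image_subset_iff)
  qed
  have AW: "A n v \<in> W" if v: "v \<in> W" for n v
  proof -
    have lin: "linear (\<lambda>v. horizontal_scaling (c n) (A n v))"
      using linear_compose[OF linA[of n] linear_horizontal_scaling] by (simp add: comp_def)
    have "(\<lambda>v. horizontal_scaling (c n) (A n v)) ` W \<subseteq> W"
      unfolding W_def linear_span_image[OF lin, symmetric] using invariant by (intro span_mono) auto
    then have "horizontal_scaling (c n) (A n v) \<in> W" using v by auto
    from horizontal_scaling_in_subspace[OF subW eW this, of "1 / c n"] show ?thesis using c0[of n] by simp
  qed
  have B0W: "B0 v \<in> W" if v: "v \<in> W" for v
    using closed_sequentially[OF closed_subspace[OF subW] _ limB] BW[OF v] by blast
  obtain k where "k \<in> rel_interior K"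
    using K(2) rel_interior_eq_empty[of K] by (auto simp: convex_cone_def)
  moreover have "affine hull K = W"
    unfolding W_def using convex_cone_contains_0[OF K(2)] by (intro affine_hull_span_0) (simp add: hull_inc)
  ultimately obtain r where k: "k \<in> K" and r: "r > 0" "cball k r \<inter> W \<subseteq> K"
    unfolding mem_rel_interior_cball by auto
  \<comment> \<open>Rescaled symmetries flatten \<open>K\<close> in the limit: a disc of radius
    \<open>r\<close> about the relative interior point \<open>k\<close> becomes a horizontal disc
    about \<open>y\<close> inside \<open>K\<close>.\<close>
  define y where "y = (fst (A0 k), 0 :: real)"
  have face: "y + r *\<^sub>R z \<in> K" if z: "z \<in> W" "snd z = 0" "norm z \<le> 1" for z
  proof -
    have "k + r *\<^sub>R B0 z \<in> K"
    proof -
      have "k + r *\<^sub>R B0 z \<in> W"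
        using KW k B0W[OF z(1)] subW by (intro subspace_add subspace_scale) auto
      moreover have "dist k (k + r *\<^sub>R B0 z) \<le> r"
        using r(1) z(3) by (simp add: dist_norm B0_norm mult_left_le)
      ultimately show ?thesis using r(2) by auto
    qed
    then have "(fst (A0 k + r *\<^sub>R z), 0) \<in> K"
      using horizontal A0_lin[of k r "B0 z"] A0B0[of z] by metis
    moreover have "(fst (A0 k + r *\<^sub>R z), 0) = y + r *\<^sub>R z"
      using z(2) by (simp add: y_def prod_eq_iff)
    ultimately show ?thesis by simp
  qed
  \<comment> \<open>On horizontal vectors the inverse symmetry is \<open>B n\<close> divided by
    \<open>c n\<close>. Multiplying back gives a congruent disc about \<open>B n y\<close>, now
    orthogonal to \<open>w n\<close>.\<close>
  have moved_face: "B n y + r *\<^sub>R d \<in> K" if d: "d \<in> W" "d \<bullet> w n = 0" "norm d \<le> 1" for n d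
  proof -
    have "snd (A n d) = A n d \<bullet> A n (w n)" by (simp add: snd_inner w_def AB)
    then have s: "snd (A n d) = 0" using d by (simp add: Ainner)
    have "y + r *\<^sub>R A n d \<in> K"
      using d AW s by (intro face) (auto simp: orthogonal_transformation_norm[OF A])
    from scale[OF pull[OF this, of n], of "c n"]
    have "c n *\<^sub>R B n (horizontal_scaling (1 / c n) (y + r *\<^sub>R A n d)) \<in> K"
      using less_imp_le[OF c(1)[of n]] by blast
    moreover have "horizontal_scaling (1 / c n) (y + r *\<^sub>R A n d) = (1 / c n) *\<^sub>R (y + r *\<^sub>R A n d)"
      using s by (simp add: horizontal_scaling_def prod_eq_iff y_def)
    ultimately show ?thesis
      using c0[of n] by (simp add: linear_scale[OF linB] linear_add[OF linB] AB scaleR_add_right)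
  qed
  have yw: "B n y \<bullet> w n = 0" for n
    by (simp add: w_def Binner snd_inner[symmetric]) (simp add: y_def)
  have ww: "w n \<bullet> w n = 1" for n
    by (simp add: w_def Binner) (simp add: e_def inner_prod_def)
  \<comment> \<open>The disc about \<open>B n y\<close> lies above the hyperplane orthogonal to
    \<open>w m\<close>. Testing a point in its direction of steepest descent bounds the height of
    the centre from below.\<close>
  have gap: "B n y \<bullet> w m * norm (w m - w n) \<ge> r * (1 - (w m \<bullet> w n)\<^sup>2)" if mn: "m \<noteq> n" for m n
  proof -
    define \<tau> where "\<tau> = w m \<bullet> w n"
    define \<delta> where "\<delta> = norm (w m - w n)"
    have \<delta>: "\<delta> > 0" using distinct[OF mn] by (simp add: \<delta>_def w_def e_def)
    have \<delta>2: "\<delta>\<^sup>2 = 2 - 2 * \<tau>"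
      unfolding \<delta>_def \<tau>_def by (rule norm_diff_unit[OF ww ww])
    \<comment> \<open>The projection of \<open>- w m\<close> orthogonal to \<open>w n\<close>,
      divided by the chord \<open>\<delta>\<close>, which is at least its length.\<close>
    define d where "d = (1 / \<delta>) *\<^sub>R (\<tau> *\<^sub>R w n - w m)"
    have "(norm (\<tau> *\<^sub>R w n - w m))\<^sup>2 = 1 - \<tau>\<^sup>2"
      unfolding \<tau>_def by (rule norm_projection_unit[OF ww ww])
    also have "\<dots> \<le> \<delta>\<^sup>2"
      unfolding \<delta>2 using zero_le_power2[of "1 - \<tau>"] unfolding power2_diff by simp
    finally have "norm (\<tau> *\<^sub>R w n - w m) \<le> \<delta>" using power2_le_imp_le less_imp_le[OF \<delta>] by blast
    then have "norm d \<le> 1" using \<delta> by (simp add: d_def divide_simps)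
    moreover have "d \<in> W"
      unfolding d_def using wK KW subW by (intro subspace_scale subspace_diff) auto
    moreover have "d \<bullet> w n = 0"
      by (simp add: d_def inner_diff_left ww \<tau>_def)
    ultimately have "(B n y + r *\<^sub>R d) \<bullet> w m \<ge> 0"
      using moved_face above by blast
    moreover have "d \<bullet> w m = (\<tau>\<^sup>2 - 1) / \<delta>"
      by (simp add: d_def inner_diff_left ww inner_commute[of "w n" "w m"] \<tau>_def[symmetric] power2_eq_square)
    ultimately have "B n y \<bullet> w m + r * ((\<tau>\<^sup>2 - 1) / \<delta>) \<ge> 0"
      by (simp add: inner_add_left)
    then have "r * (1 - \<tau>\<^sup>2) / \<delta> \<le> B n y \<bullet> w m" by (simp add: diff_divide_distrib right_diff_distrib)
    then have "r * (1 - \<tau>\<^sup>2) \<le> B n y \<bullet> w m * \<delta>" using \<delta> by (simp add: pos_divide_le_eq)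
    then show ?thesis by (simp add: \<tau>_def \<delta>_def)
  qed
  \<comment> \<open>Since \<open>B n y\<close> is orthogonal to \<open>w n\<close>, the two heights
    add up to \<open>(B n y - B m y) \<bullet> (w m - w n)\<close>. As
    \<open>2 * (1 - \<tau>\<^sup>2) = (1 + \<tau>) * \<delta>\<^sup>2\<close>, Cauchy-Schwarz leaves
    a distance bound independent of \<open>m\<close> and \<open>n\<close>.\<close>
  have far: "norm (B n y - B m y) \<ge> r" if mn: "m \<noteq> n" and pos: "w m \<bullet> w n \<ge> 0" for m n
  proof -
    define \<tau> where "\<tau> = w m \<bullet> w n"
    define \<delta> where "\<delta> = norm (w m - w n)"
    have \<delta>: "\<delta> > 0" using distinct[OF mn] by (simp add: \<delta>_def w_def e_def)
    have \<delta>2: "\<delta>\<^sup>2 = 2 - 2 * \<tau>"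
      unfolding \<delta>_def \<tau>_def by (rule norm_diff_unit[OF ww ww])
    have "r * (1 - \<tau>\<^sup>2) + r * (1 - \<tau>\<^sup>2) \<le> (B n y \<bullet> w m + B m y \<bullet> w n) * \<delta>"
      using gap[OF mn] gap[OF mn[symmetric]]
      by (simp add: \<tau>_def \<delta>_def inner_commute[of "w n" "w m"] norm_minus_commute[of "w n" "w m"] algebra_simps)
    moreover have "r * (1 - \<tau>\<^sup>2) + r * (1 - \<tau>\<^sup>2) = r * (1 + \<tau>) * \<delta>\<^sup>2"
      unfolding \<delta>2 by (simp add: power2_eq_square algebra_simps)
    moreover have "r * \<delta>\<^sup>2 \<le> r * (1 + \<tau>) * \<delta>\<^sup>2"
      using r(1) pos by (intro mult_right_mono) (auto simp: \<tau>_def)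
    moreover have "(B n y \<bullet> w m + B m y \<bullet> w n) * \<delta> = (B n y - B m y) \<bullet> (w m - w n) * \<delta>"
      by (simp add: inner_diff_left inner_diff_right yw)
    moreover have "(B n y - B m y) \<bullet> (w m - w n) * \<delta> \<le> norm (B n y - B m y) * \<delta> * \<delta>"
      unfolding \<delta>_def by (intro mult_right_mono norm_cauchy_schwarz) auto
    moreover have "norm (B n y - B m y) * \<delta> * \<delta> = norm (B n y - B m y) * \<delta>\<^sup>2"
      by (simp add: power2_eq_square)
    ultimately have "r * \<delta>\<^sup>2 \<le> norm (B n y - B m y) * \<delta>\<^sup>2" by linarith
    then show ?thesis using \<delta> by simp
  qed
  \<comment> \<open>Convergence eventually brings the centres closer than \<open>r\<close> and makes
    \<open>w m \<bullet> w n\<close> nonnegative, against \<open>far\<close>.\<close>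
  have "Cauchy (\<lambda>n. B n y)" using limB LIMSEQ_imp_Cauchy by blast
  then obtain M where M: "\<And>m n. m \<ge> M \<Longrightarrow> n \<ge> M \<Longrightarrow> norm (B m y - B n y) < r"
    using r(1) unfolding Cauchy_iff by meson
  have "Cauchy w" unfolding w_def using limB LIMSEQ_imp_Cauchy by blast
  then obtain N where N: "\<And>m n. m \<ge> N \<Longrightarrow> n \<ge> N \<Longrightarrow> norm (w m - w n) < 1"
    unfolding Cauchy_iff by (meson zero_less_one)
  define n where "n = max M N"
  have "(norm (w (Suc n) - w n))\<^sup>2 < 1"
    using N[of "Suc n" n] by (intro power_less_one_iff[THEN iffD2]) (auto simp: n_def abs_square_less_1)
  then have "w (Suc n) \<bullet> w n \<ge> 0"
    unfolding norm_diff_unit[OF ww ww] by simp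
  then show False using far[of "Suc n" n] M[of n "Suc n"] by (force simp: n_def)
qed

text \<open>Orthogonal maps have operator norm at most 1, and bounded sequences in a
  finite-dimensional space of linear maps have convergent subsequences.\<close>

lemma orthogonal_sequence_convergent_subsequence:
  fixes A :: "nat \<Rightarrow> 'a::euclidean_space \<Rightarrow> 'a"
  assumes A: "\<And>n. orthogonal_transformation (A n)"
  obtains r A0 where "strict_mono (r :: nat \<Rightarrow> nat)" "\<And>v. (\<lambda>n. A (r n) v) \<longlonglongrightarrow> A0 v"
proof -
  have bl: "bounded_linear (A n)" for n
    using A orthogonal_transformation_linear linear_conv_bounded_linear by blast
  have app: "blinfun_apply (Blinfun (A n)) = A n" for n
    by (rule bounded_linear_Blinfun_apply[OF bl])
  have "norm (Blinfun (A n)) \<le> 1" for n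
    by (rule norm_blinfun_bound) (auto simp: app orthogonal_transformation_norm[OF A])
  then have "bounded (range (\<lambda>n. Blinfun (A n)))"
    unfolding bounded_iff by blast
  then obtain l r where r: "strict_mono r" "((\<lambda>n. Blinfun (A n)) \<circ> r) \<longlonglongrightarrow> l"
    using bounded_imp_convergent_subsequence by blast
  have "(\<lambda>n. A (r n) v) \<longlonglongrightarrow> blinfun_apply l v" for v
  proof -
    have "(\<lambda>n. blinfun_apply (((\<lambda>n. Blinfun (A n)) \<circ> r) n) v) \<longlonglongrightarrow> blinfun_apply l v"
      by (intro tendsto_intros r)
    then show ?thesis by (simp add: app)
  qed
  then show thesis using that r(1) by blast
qed

text \<open>Reduces to the convergent case: the sign of each symmetry is absorbed into its
  orthogonal part, and compactness is applied to these maps and then to their inverses.\<close>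

lemma no_pointed_invariant_cone:
  fixes K :: "('a::euclidean_space \<times> real) set"
    and A :: "nat \<Rightarrow> 'a \<times> real \<Rightarrow> 'a \<times> real"
  assumes K: "closed K" "convex_cone K" "(0, 1) \<in> K"
    and pointed: "\<And>v. v \<in> K \<Longrightarrow> - v \<in> K \<Longrightarrow> v = 0"
    and A: "\<And>n. orthogonal_transformation (A n)"
    and c: "\<And>n. c n > 0" "filterlim c at_top sequentially"
    and invariant: "\<And>n. (\<forall>v. horizontal_scaling (c n) (A n v) \<in> K \<longleftrightarrow> v \<in> K) \<or>
                        (\<forall>v. - horizontal_scaling (c n) (A n v) \<in> K \<longleftrightarrow> v \<in> K)"
    and distinct: "\<And>m n. m \<noteq> n \<Longrightarrow> A m (inv (A n) (0, 1)) \<notin> {(0, 1), (0, -1)}"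
  shows False
proof -
  define \<sigma> where "\<sigma> n = (if \<forall>v. horizontal_scaling (c n) (A n v) \<in> K \<longleftrightarrow> v \<in> K then 1 else -1 :: real)" for n
  define A' where "A' n v = \<sigma> n *\<^sub>R A n v" for n v
  have \<sigma>: "\<sigma> n = 1 \<or> \<sigma> n = -1" for n by (simp add: \<sigma>_def)
  have A': "orthogonal_transformation (A' n)" for n
    using \<sigma>[of n] A[of n] by (auto simp: A'_def[abs_def] orthogonal_transformation_neg)
  have neg: "horizontal_scaling t (- v) = - horizontal_scaling t v" for t and v :: "'a \<times> real"
    by (simp add: horizontal_scaling_def)
  have inv': "horizontal_scaling (c n) (A' n v) \<in> K \<longleftrightarrow> v \<in> K" for n v
    using invariant[of n] by (simp add: A'_def \<sigma>_def neg del: split_paired_All split: if_split) blast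
  define B where "B n = inv (A' n)" for n
  have AB: "A' n (B n v) = v" "B n (A' n v) = v" for n v
    using orthogonal_transformation_bij[OF A'[of n]]
    by (auto simp: B_def bij_is_surj surj_f_inv_f bij_is_inj)
  have B: "orthogonal_transformation (B n)" for n
    unfolding B_def by (rule orthogonal_transformation_inv[OF A'])
  obtain r A0 where r: "strict_mono r" "\<And>v. (\<lambda>n. A' (r n) v) \<longlonglongrightarrow> A0 v"
    using orthogonal_sequence_convergent_subsequence[of A', OF A'] by blast
  obtain s B0 where s: "strict_mono s" "\<And>v. (\<lambda>n. B (r (s n)) v) \<longlonglongrightarrow> B0 v"
    using orthogonal_sequence_convergent_subsequence[of "\<lambda>n. B (r n)", OF B] by blast
  define q where "q n = r (s n)" for n
  have q: "strict_mono q"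
    using strict_mono_o[OF r(1) s(1)] by (simp add: q_def[abs_def] comp_def)
  show False
  proof (rule no_pointed_invariant_cone_convergent[OF K pointed, of "\<lambda>n. A' (q n)" "\<lambda>n. B (q n)" A0 B0 "\<lambda>n. c (q n)"])
    show "(\<lambda>n. A' (q n) v) \<longlonglongrightarrow> A0 v" for v
      using LIMSEQ_subseq_LIMSEQ[OF r(2)[of v] s(1)] by (simp add: q_def comp_def)
    show "(\<lambda>n. B (q n) v) \<longlonglongrightarrow> B0 v" for v
      using s(2) by (simp add: q_def)
    show "filterlim (\<lambda>n. c (q n)) at_top sequentially"
      using filterlim_compose[OF c(2) filterlim_subseq[OF q]] .
    \<comment> \<open>Equal preimages under the signed maps mean that both unsigned maps send one
      line to the vertical axis.\<close>
    show "B (q m) (0, 1) \<noteq> B (q n) (0, 1)" if "m \<noteq> n" for m n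
    proof
      assume eq: "B (q m) (0, 1) = B (q n) (0, 1)"
      define v where "v = B (q n) (0, 1)"
      have "A' (q m) v = (0, 1)" "A' (q n) v = (0, 1)"
        using AB(1)[of "q m" "(0, 1)"] AB(1)[of "q n" "(0, 1)"] eq by (auto simp: v_def)
      then have *: "A (q m) v = \<sigma> (q m) *\<^sub>R (0, 1)" "A (q n) v = \<sigma> (q n) *\<^sub>R (0, 1)"
        using \<sigma>[of "q m"] \<sigma>[of "q n"] by (auto simp: A'_def minus_equation_iff)
      have "inv (A (q n)) (0, 1) = \<sigma> (q n) *\<^sub>R v"
      proof (rule inv_f_eq)
        show "inj (A (q n))" by (rule orthogonal_transformation_inj[OF A])
        show "A (q n) (\<sigma> (q n) *\<^sub>R v) = (0, 1)"
          using \<sigma>[of "q n"] *(2) by (auto simp: orthogonal_transformation_scaleR[OF A])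
      qed
      then have "A (q m) (inv (A (q n)) (0, 1)) \<in> {(0, 1), (0, -1)}"
        using \<sigma>[of "q n"] \<sigma>[of "q m"] *(1) by (auto simp: orthogonal_transformation_scaleR[OF A])
      moreover have "q m \<noteq> q n" using q that by (auto dest: strict_mono_eq)
      ultimately show False using distinct by blast
    qed
  qed (use A' B AB c(1) inv' in auto)
qed

section \<open>Functions invariant under affine maps\<close>

text \<open>Iterating \<open>h\<close> drives every point to its fixed point \<open>z\<close>, while
  each step keeps the absolute value of \<open>f - f z\<close>; by continuity this value is
  0.\<close>

lemma constant_if_contraction_invariant:
  fixes f :: "'a::complete_space \<Rightarrow> real" and h :: "'a \<Rightarrow> 'a"
  assumes f: "continuous_on UNIV f"
    and \<kappa>: "0 \<le> \<kappa>" "\<kappa> < 1" and h: "\<And>x y. dist (h x) (h y) \<le> \<kappa> * dist x y"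
    and inv: "\<And>x. f (h x) = s * f x + k" and s: "\<bar>s\<bar> = 1"
  shows "f x = f y"
proof -
  obtain z where z: "h z = z"
    using banach_fix_type[OF \<kappa>, of h] h by auto
  have "f x = f z" for x
  proof -
    have d: "dist ((h ^^ n) x) z \<le> \<kappa> ^ n * dist x z" for n
    proof (induction n)
      case (Suc n)
      have "dist (h ((h ^^ n) x)) (h z) \<le> \<kappa> * dist ((h ^^ n) x) z" by (rule h)
      also have "\<dots> \<le> \<kappa> * (\<kappa> ^ n * dist x z)" by (intro mult_left_mono Suc \<kappa>)
      finally show ?case using z by simp
    qed simp
    have "(\<lambda>n. \<kappa> ^ n * dist x z) \<longlonglongrightarrow> 0 * dist x z"
      using \<kappa> by (intro tendsto_intros LIMSEQ_realpow_zero) auto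
    then have "(\<lambda>n. \<kappa> ^ n * dist x z) \<longlonglongrightarrow> 0" by simp
    then have "(\<lambda>n. dist ((h ^^ n) x) z) \<longlonglongrightarrow> 0"
      by (rule tendsto_sandwich[OF _ _ tendsto_const, rotated 2]) (use d in auto)
    then have "(\<lambda>n. (h ^^ n) x) \<longlonglongrightarrow> z" by (rule tendsto_dist_iff[THEN iffD2])
    then have "(\<lambda>n. f ((h ^^ n) x)) \<longlonglongrightarrow> f z"
      using f by (intro isCont_tendsto_compose[of z f]) (auto simp: continuous_on_eq_continuous_at)
    then have "(\<lambda>n. \<bar>f ((h ^^ n) x) - f z\<bar>) \<longlonglongrightarrow> \<bar>f z - f z\<bar>" by (intro tendsto_intros)
    moreover have "\<bar>f ((h ^^ n) x) - f z\<bar> = \<bar>f x - f z\<bar>" for n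
    proof (induction n)
      case (Suc n)
      have "f ((h ^^ Suc n) x) - f z = s * (f ((h ^^ n) x) - f z)"
        using inv[of z] inv[of "(h ^^ n) x"] z by (simp add: algebra_simps)
      then show ?case using Suc s by (simp add: abs_mult)
    qed simp
    ultimately have "\<bar>f x - f z\<bar> = 0" using LIMSEQ_unique[OF tendsto_const] by force
    then show ?thesis by simp
  qed
  then show ?thesis by metis
qed

text \<open>\<open>k / (1 - \<sigma>)\<close> is the fixed point of the substitution. Measured from
  there, the relation loses its additive constants and can be iterated.\<close>

lemma homogeneous_iterate:
  fixes g :: "real \<Rightarrow> real"
  assumes inv: "\<And>y. g (\<sigma> * y + k) = \<tau> * g y + l" and \<sigma>: "\<bar>\<sigma>\<bar> > 1"
  shows "g (k / (1 - \<sigma>) + \<sigma> ^ j * z) - g (k / (1 - \<sigma>)) = \<tau> ^ j * (g (k / (1 - \<sigma>) + z) - g (k / (1 - \<sigma>)))"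
proof (induction j)
  case (Suc j)
  define a where "a = k / (1 - \<sigma>)"
  have "1 - \<sigma> \<noteq> 0" using \<sigma> by auto
  then have a: "\<sigma> * a + k = a" by (simp add: a_def field_simps)
  then have "a + \<sigma> ^ Suc j * z = \<sigma> * (a + \<sigma> ^ j * z) + k"
    by (simp add: algebra_simps)
  then have "g (a + \<sigma> ^ Suc j * z) = \<tau> * g (a + \<sigma> ^ j * z) + l"
    using inv by metis
  moreover have "g a = \<tau> * g a + l" using inv[of a] a by simp
  ultimately have "g (a + \<sigma> ^ Suc j * z) - g a = \<tau> * (g (a + \<sigma> ^ j * z) - g a)"
    by (simp add: right_diff_distrib)
  then show ?case using Suc by (simp add: a_def)
qed simp

text \<open>Along the orbit \<open>\<sigma>1 ^ j * z\<close> the increments of \<open>g\<close> grow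
  like \<open>\<tau>1 ^ j\<close>, while the second relation bounds them on balls of radius
  \<open>\<bar>\<sigma>2\<bar> ^ i\<close> by a multiple of \<open>\<bar>\<tau>2\<bar> ^ i\<close>.
  Matching the radii and letting \<open>j\<close> grow compares the exponents
  \<open>ln \<bar>\<tau>\<bar> / ln \<bar>\<sigma>\<bar>\<close>.\<close>

lemma growth_exponent_le:
  fixes g :: "real \<Rightarrow> real"
  assumes g: "continuous_on UNIV g" and nonconst: "g a \<noteq> g b"
    and inv1: "\<And>y. g (\<sigma>1 * y + k1) = \<tau>1 * g y + l1" "\<bar>\<sigma>1\<bar> > 1" "\<tau>1 \<noteq> 0"
    and inv2: "\<And>y. g (\<sigma>2 * y + k2) = \<tau>2 * g y + l2" "\<bar>\<sigma>2\<bar> > 1" "\<tau>2 \<noteq> 0"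
  shows "ln \<bar>\<tau>1\<bar> * ln \<bar>\<sigma>2\<bar> \<le> ln \<bar>\<tau>2\<bar> * ln \<bar>\<sigma>1\<bar>"
proof -
  define x1 where "x1 = k1 / (1 - \<sigma>1)"
  define x2 where "x2 = k2 / (1 - \<sigma>2)"
  note it1 = homogeneous_iterate[of g \<sigma>1 k1 \<tau>1 l1, OF inv1(1,2), folded x1_def]
  note it2 = homogeneous_iterate[of g \<sigma>2 k2 \<tau>2 l2, OF inv2(1,2), folded x2_def]
  obtain z where z: "g (x1 + z) \<noteq> g x1"
    using nonconst by (metis add.commute diff_add_cancel)
  define \<delta> where "\<delta> = \<bar>g (x1 + z) - g x1\<bar>"
  have \<delta>: "\<delta> > 0" using z by (simp add: \<delta>_def)
  have "bounded ((\<lambda>z. g (x2 + z) - g x2) ` cball 0 1)"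
    by (intro compact_imp_bounded compact_continuous_image continuous_intros continuous_on_compose2[OF g]) auto
  then obtain M where M: "M > 0" "\<And>z. \<bar>z\<bar> \<le> 1 \<Longrightarrow> \<bar>g (x2 + z) - g x2\<bar> \<le> M"
    unfolding bounded_pos by (auto simp: dist_real_def)
  have upper: "\<bar>g q - g x2\<bar> \<le> M * \<bar>\<tau>2\<bar> ^ i" if "\<bar>q - x2\<bar> \<le> \<bar>\<sigma>2\<bar> ^ i" for q i
  proof -
    have s: "\<sigma>2 ^ i \<noteq> 0" using inv2(2) by auto
    have "\<bar>(q - x2) / \<sigma>2 ^ i\<bar> \<le> 1"
      using that s by (simp add: abs_divide divide_le_eq power_abs)
    from M(2)[OF this] have "\<bar>\<tau>2 ^ i\<bar> * \<bar>g (x2 + (q - x2) / \<sigma>2 ^ i) - g x2\<bar> \<le> \<bar>\<tau>2 ^ i\<bar> * M"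
      by (intro mult_left_mono) auto
    moreover have "g q - g x2 = \<tau>2 ^ i * (g (x2 + (q - x2) / \<sigma>2 ^ i) - g x2)"
      using it2[of i "(q - x2) / \<sigma>2 ^ i"] nonzero_mult_div_cancel_left[OF s, of "q - x2"] by simp
    ultimately show ?thesis by (simp add: abs_mult power_abs mult.commute)
  qed
  \<comment> \<open>Large enough that the ball of radius
    \<open>Q * \<bar>\<sigma>1\<bar> ^ j\<close> about \<open>x2\<close> contains \<open>x1\<close>
    and the orbit point.\<close>
  define Q where "Q = \<bar>z\<bar> + \<bar>x1 - x2\<bar> + 1"
  have Q: "Q \<ge> 1" by (simp add: Q_def)
  define s1 s2 t1 t2 where "s1 = ln \<bar>\<sigma>1\<bar>" and "s2 = ln \<bar>\<sigma>2\<bar>" and "t1 = ln \<bar>\<tau>1\<bar>" and "t2 = ln \<bar>\<tau>2\<bar>"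
  have s: "s1 > 0" "s2 > 0" using inv1(2) inv2(2) by (auto simp: s1_def s2_def)
  \<comment> \<open>All that does not depend on \<open>j\<close>; the last term pays for rounding
    \<open>X\<close> up, whatever the sign of \<open>t2\<close>.\<close>
  define E where "E = ln (2 * M) - ln \<delta> + ln Q / s2 * t2 + \<bar>t2\<bar>"
  have main: "real j * (t1 - s1 * t2 / s2) \<le> E" for j
  proof -
    \<comment> \<open>The real exponent at which the power of \<open>\<bar>\<sigma>2\<bar>\<close>
      equals \<open>Q * \<bar>\<sigma>1\<bar> ^ j\<close>.\<close>
    define X where "X = (ln Q + real j * s1) / s2"
    have X: "X \<ge> 0" using Q s by (simp add: X_def)
    define i where "i = nat \<lceil>X\<rceil>"
    have i: "real i \<ge> X" "real i \<le> X + 1" using X by (auto simp: i_def)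
    have "ln (Q * \<bar>\<sigma>1\<bar> ^ j) = X * s2"
      using Q s inv1(2) by (simp add: X_def ln_mult ln_realpow s1_def)
    also have "\<dots> \<le> real i * s2" using i s by simp
    also have "\<dots> = ln (\<bar>\<sigma>2\<bar> ^ i)" using inv2(2) by (simp add: ln_realpow s2_def)
    finally have le: "Q * \<bar>\<sigma>1\<bar> ^ j \<le> \<bar>\<sigma>2\<bar> ^ i"
      using Q inv1(2) inv2(2) by (subst (asm) ln_le_cancel_iff) auto
    have one: "1 \<le> \<bar>\<sigma>1\<bar> ^ j" using inv1(2) by simp
    have "\<bar>x1 - x2\<bar> \<le> Q * 1" by (simp add: Q_def)
    also have "\<dots> \<le> Q * \<bar>\<sigma>1\<bar> ^ j" using one Q by (intro mult_left_mono) auto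
    also note le
    finally have d1: "\<bar>x1 - x2\<bar> \<le> \<bar>\<sigma>2\<bar> ^ i" .
    have "\<bar>x1 + \<sigma>1 ^ j * z - x2\<bar> \<le> \<bar>x1 - x2\<bar> * 1 + \<bar>z\<bar> * \<bar>\<sigma>1\<bar> ^ j"
      using abs_triangle_ineq[of "x1 - x2" "\<sigma>1 ^ j * z"] by (simp add: abs_mult power_abs algebra_simps)
    also have "\<dots> \<le> \<bar>x1 - x2\<bar> * \<bar>\<sigma>1\<bar> ^ j + \<bar>z\<bar> * \<bar>\<sigma>1\<bar> ^ j"
      using one by (intro add_mono mult_left_mono) auto
    also have "\<dots> \<le> Q * \<bar>\<sigma>1\<bar> ^ j" by (simp add: Q_def algebra_simps)
    also note le
    finally have d2: "\<bar>x1 + \<sigma>1 ^ j * z - x2\<bar> \<le> \<bar>\<sigma>2\<bar> ^ i" .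
    have "\<bar>\<tau>1\<bar> ^ j * \<delta> = \<bar>g (x1 + \<sigma>1 ^ j * z) - g x1\<bar>"
      by (simp add: it1 \<delta>_def abs_mult power_abs)
    also have "\<dots> \<le> 2 * M * \<bar>\<tau>2\<bar> ^ i"
      using upper[OF d1] upper[OF d2] by linarith
    finally have "ln (\<bar>\<tau>1\<bar> ^ j * \<delta>) \<le> ln (2 * M * \<bar>\<tau>2\<bar> ^ i)"
      using \<delta> M(1) inv1(3) inv2(3) by (subst ln_le_cancel_iff) auto
    then have A: "real j * t1 + ln \<delta> \<le> ln (2 * M) + real i * t2"
      using \<delta> M(1) inv1(3) inv2(3) by (simp add: ln_mult ln_realpow t1_def t2_def)
    have "(real i - X) * t2 \<le> 1 * \<bar>t2\<bar>"
    proof -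
      have "(real i - X) * t2 \<le> (real i - X) * \<bar>t2\<bar>" using i by (intro mult_left_mono) auto
      also have "\<dots> \<le> 1 * \<bar>t2\<bar>" using i by (intro mult_right_mono) auto
      finally show ?thesis .
    qed
    then have "real i * t2 \<le> X * t2 + \<bar>t2\<bar>" by (simp add: algebra_simps)
    moreover have "X * t2 = ln Q / s2 * t2 + real j * (s1 * t2 / s2)"
      by (simp add: X_def add_divide_distrib algebra_simps)
    ultimately show ?thesis using A by (simp add: E_def right_diff_distrib)
  qed
  have "t1 - s1 * t2 / s2 \<le> 0"
  proof (rule ccontr)
    assume "\<not> t1 - s1 * t2 / s2 \<le> 0"
    then obtain j where "E < real j * (t1 - s1 * t2 / s2)"
      using reals_Archimedean3[of "t1 - s1 * t2 / s2"] by auto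
    then show False using main[of j] by simp
  qed
  then have "t1 * s2 \<le> s1 * t2" using s by (simp add: field_simps)
  then show ?thesis by (simp add: s1_def s2_def t1_def t2_def mult.commute)
qed

lemma growth_exponent_unique:
  fixes g :: "real \<Rightarrow> real"
  assumes "continuous_on UNIV g" "g a \<noteq> g b"
    and "\<And>y. g (\<sigma>1 * y + k1) = \<tau>1 * g y + l1" "\<bar>\<sigma>1\<bar> > 1" "\<tau>1 \<noteq> 0"
    and "\<And>y. g (\<sigma>2 * y + k2) = \<tau>2 * g y + l2" "\<bar>\<sigma>2\<bar> > 1" "\<tau>2 \<noteq> 0"
  shows "ln \<bar>\<tau>1\<bar> * ln \<bar>\<sigma>2\<bar> = ln \<bar>\<tau>2\<bar> * ln \<bar>\<sigma>1\<bar>"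
  using growth_exponent_le[OF assms(1,2,3,4,5,6,7,8)] growth_exponent_le[OF assms(1,2,6,7,8,3,4,5)]
  by simp

section \<open>Planar cones invariant under stretched rotations\<close>

text \<open>The slopes of the rays in the open right half-plane form a closed set, bounded below
  because ever steeper descending rays would converge to the excluded \<open>(0, -1)\<close>. The
  least slope gives the edge; if there are no such rays, the vertical ray serves.\<close>

lemma planar_cone_right_edge:
  fixes K :: "(real \<times> real) set"
  assumes K: "closed K" "convex_cone K" "(0, 1) \<in> K" and down: "(0, -1) \<notin> K"
  obtains p where "p \<in> K" "p = (0, 1) \<or> fst p = 1"
    "\<And>v. v \<in> K \<Longrightarrow> fst v \<ge> 0 \<Longrightarrow> \<exists>a\<ge>0. \<exists>b\<ge>0. v = a *\<^sub>R p + b *\<^sub>R (0, 1)"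
proof -
  have scale: "r *\<^sub>R v \<in> K" if "v \<in> K" "r \<ge> 0" for r v
    using convex_cone_scaleR[OF K(2)] that by blast
  have add: "v + w \<in> K" if "v \<in> K" "w \<in> K" for v w
    using convex_cone_add[OF K(2)] that by blast
  have vert: "snd v \<ge> 0" if "v \<in> K" "fst v = 0" for v
  proof (rule ccontr)
    assume "\<not> snd v \<ge> 0"
    then have "(- 1 / snd v) *\<^sub>R v \<in> K" "(- 1 / snd v) *\<^sub>R v = (0, -1)"
      using that scale[of v "- 1 / snd v"] by (auto simp: prod_eq_iff divide_nonpos_neg)
    then show False using down by simp
  qed
  define R where "R = {s. (1, s) \<in> K}"
  show thesis
  proof (cases "R = {}")
    case True
    have "fst v = 0" if "v \<in> K" "fst v \<ge> 0" for v
    proof (rule ccontr)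
      assume "fst v \<noteq> 0"
      then have "(1, snd v / fst v) \<in> K"
        using scale[of v "1 / fst v"] that by (cases v) simp
      then show False using True by (auto simp: R_def)
    qed
    then have "\<exists>a\<ge>0. \<exists>b\<ge>0. v = a *\<^sub>R (0, 1) + b *\<^sub>R (0, 1)" if "v \<in> K" "fst v \<ge> 0" for v
      using that vert[of v] by (intro exI[of _ 0] conjI exI[of _ "snd v"]) (auto simp: prod_eq_iff)
    then show thesis using that[of "(0, 1)"] K(3) by blast
  next
    case False
    have clR: "closed R"
    proof -
      have "R = (\<lambda>s. (1, s)) -` K" by (auto simp: R_def)
      then show ?thesis using K(1) by (auto intro!: closed_vimage continuous_intros)
    qed
    have up: "s' \<in> R" if "s \<in> R" "s \<le> s'" for s s'
      using add[of "(1, s)" "(s' - s) *\<^sub>R (0, 1)"] scale[OF K(3), of "s' - s"] that by (simp add: R_def)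
    have bdd: "bdd_below R"
    proof (rule ccontr)
      assume "\<not> bdd_below R"
      then have "\<exists>s\<in>R. s < - real (Suc n)" for n
        unfolding bdd_below_def by (meson not_le)
      then have "- real (Suc n) \<in> R" for n using up by (meson less_imp_le)
      then have "(1 / real (Suc n)) *\<^sub>R (1, - real (Suc n)) \<in> K" for n
        by (intro scale) (auto simp: R_def)
      moreover have "(1 / real (Suc n)) *\<^sub>R (1, - real (Suc n)) = (inverse (real (Suc n)), -1)" for n
        by (simp add: prod_eq_iff inverse_eq_divide del: of_nat_Suc)
      ultimately have mem: "(inverse (real (Suc n)), -1) \<in> K" for n by metis
      have "(\<lambda>n. (inverse (real (Suc n)), -1 :: real)) \<longlonglongrightarrow> (0, -1)"
        by (intro tendsto_intros LIMSEQ_inverse_real_of_nat)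
      then show False using closed_sequentially[OF K(1), of "\<lambda>n. (inverse (real (Suc n)), -1)"] mem down by blast
    qed
    define m where "m = Inf R"
    have mR: "m \<in> R" unfolding m_def by (rule closed_contains_Inf[OF False bdd clR])
    have "\<exists>a\<ge>0. \<exists>b\<ge>0. v = a *\<^sub>R (1, m) + b *\<^sub>R (0, 1)" if v: "v \<in> K" "fst v \<ge> 0" for v
    proof (cases "fst v = 0")
      case True
      then show ?thesis using v vert[of v]
        by (intro exI[of _ 0] conjI exI[of _ "snd v"]) (auto simp: prod_eq_iff)
    next
      case False
      then have "snd v / fst v \<in> R"
        using scale[of v "1 / fst v"] v by (cases v) (simp add: R_def)
      then have "m \<le> snd v / fst v" unfolding m_def by (rule cInf_lower[OF _ bdd])
      then have "snd v \<ge> fst v * m" using v(2) False by (simp add: field_simps)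
      then show ?thesis using v(2)
        by (intro exI[of _ "fst v"] conjI exI[of _ "snd v - fst v * m"]) (auto simp: prod_eq_iff)
    qed
    then show thesis using that[of "(1, m)"] mR by (auto simp: R_def)
  qed
qed

text \<open>The edges are found on the right and, after a reflection, on the left. Unless both are
  vertical, the vertical vector is a nonnegative combination of them, so they alone generate
  \<open>K\<close>.\<close>

lemma planar_cone_cases:
  fixes K :: "(real \<times> real) set"
  assumes K: "closed K" "convex_cone K" "(0, 1) \<in> K"
    and pointed: "\<And>v. v \<in> K \<Longrightarrow> - v \<in> K \<Longrightarrow> v = 0"
  shows "(\<forall>v\<in>K. fst v = 0) \<or>
    (\<exists>p q. fst p * snd q - snd p * fst q \<noteq> 0 \<and> K = {a *\<^sub>R p + b *\<^sub>R q | a b. a \<ge> 0 \<and> b \<ge> 0})"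
proof -
  have scale: "r *\<^sub>R v \<in> K" if "v \<in> K" "r \<ge> 0" for r v
    using convex_cone_scaleR[OF K(2)] that by blast
  have add: "v + w \<in> K" if "v \<in> K" "w \<in> K" for v w
    using convex_cone_add[OF K(2)] that by blast
  have down: "(0, -1) \<notin> K" using pointed[of "(0, 1)"] K(3) by (auto simp: zero_prod_def)
  define \<rho> where "\<rho> v = (- fst v, snd v)" for v :: "real \<times> real"
  have \<rho>: "\<rho> (\<rho> v) = v" for v by (simp add: \<rho>_def)
  have K': "closed (\<rho> -` K)" "convex_cone (\<rho> -` K)" "(0, 1) \<in> \<rho> -` K" "(0, -1) \<notin> \<rho> -` K"
  proof -
    show "closed (\<rho> -` K)" using K(1) unfolding \<rho>_def by (intro closed_vimage continuous_intros)
    have "linear \<rho>" unfolding \<rho>_def by (intro linearI) auto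
    then show "convex_cone (\<rho> -` K)"
      using K(2) by (auto simp: convex_cone_iff linear_0 linear_add linear_scale)
  qed (use K(3) down in \<open>auto simp: \<rho>_def\<close>)
  obtain p where p: "p \<in> K" "p = (0, 1) \<or> fst p = 1"
    and p_gen: "\<And>v. v \<in> K \<Longrightarrow> fst v \<ge> 0 \<Longrightarrow> \<exists>a\<ge>0. \<exists>b\<ge>0. v = a *\<^sub>R p + b *\<^sub>R (0, 1)"
    using planar_cone_right_edge[OF K down] by metis
  obtain q' where q': "q' \<in> \<rho> -` K" "q' = (0, 1) \<or> fst q' = 1"
    and q'_gen: "\<And>v. v \<in> \<rho> -` K \<Longrightarrow> fst v \<ge> 0 \<Longrightarrow> \<exists>a\<ge>0. \<exists>b\<ge>0. v = a *\<^sub>R q' + b *\<^sub>R (0, 1)"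
    using planar_cone_right_edge[OF K'] by metis
  define q where "q = \<rho> q'"
  have q: "q \<in> K" "q = (0, 1) \<or> fst q = -1"
    using q' by (auto simp: q_def \<rho>_def)
  have q_gen: "\<exists>a\<ge>0. \<exists>b\<ge>0. v = a *\<^sub>R q + b *\<^sub>R (0, 1)" if "v \<in> K" "fst v \<le> 0" for v
  proof -
    have "\<rho> v \<in> \<rho> -` K" "fst (\<rho> v) \<ge> 0" using that \<rho>[of v] by (auto simp: \<rho>_def)
    from q'_gen[OF this] obtain a b where "a \<ge> 0" "b \<ge> 0" "\<rho> v = a *\<^sub>R q' + b *\<^sub>R (0, 1)"
      by blast
    then show ?thesis
      by (intro exI[of _ a] conjI exI[of _ b]) (auto simp: q_def \<rho>_def prod_eq_iff)
  qed
  show ?thesis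
  proof (cases "p = (0, 1) \<and> q = (0, 1)")
    case True
    have "fst v = 0" if "v \<in> K" for v
    proof (cases "fst v \<ge> 0")
      case True': True
      show ?thesis using p_gen[OF that True'] True by auto
    next
      case False
      then have "fst v \<le> 0" by simp
      then show ?thesis using q_gen[OF that] True by auto
    qed
    then show ?thesis by blast
  next
    case False
    have "\<exists>s t. fst p * snd q - snd p * fst q \<noteq> 0 \<and> s \<ge> 0 \<and> t \<ge> 0 \<and> (0, 1) = s *\<^sub>R p + t *\<^sub>R q"
    proof -
      consider "p = (0, 1)" "fst q = -1" | "fst p = 1" "q = (0, 1)" | "fst p = 1" "fst q = -1"
        using False p(2) q(2) by blast
      then show ?thesis
      proof cases
        case 1 then show ?thesis by (intro exI[of _ 1] exI[of _ 0]) auto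
      next
        case 2 then show ?thesis by (intro exI[of _ 0] exI[of _ 1]) auto
      next
        case 3
        \<comment> \<open>The edges have abscissas 1 and -1, so their sum is vertical of height
          \<open>d\<close>. A zero \<open>d\<close> would put a line into \<open>K\<close>, a
          negative one the vector \<open>(0, -1)\<close>.\<close>
        define d where "d = snd p + snd q"
        have pq: "p + q = (0, d)" using 3 by (auto simp: prod_eq_iff d_def)
        have "d > 0"
        proof (rule ccontr)
          assume neg: "\<not> d > 0"
          show False
          proof (cases "d = 0")
            case True
            then have "q = - p" using 3 by (auto simp: prod_eq_iff d_def)
            then show False using pointed[of p] p(1) q(1) 3 by auto
          next
            case False
            then have "(- 1 / d) *\<^sub>R (p + q) \<in> K"
              using neg by (intro scale[OF add[OF p(1) q(1)]]) (auto simp: divide_nonpos_neg)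
            then show False using down False by (simp add: pq)
          qed
        qed
        moreover from this have "(0, 1) = (1 / d) *\<^sub>R p + (1 / d) *\<^sub>R q"
          by (simp add: scaleR_add_right[symmetric] pq)
        moreover have "fst p * snd q - snd p * fst q \<noteq> 0" using 3 calculation(1) by (simp add: d_def)
        ultimately show ?thesis by (intro exI[of _ "1 / d"]) simp
      qed
    qed
    then obtain s t where st: "fst p * snd q - snd p * fst q \<noteq> 0" "s \<ge> 0" "t \<ge> 0" "(0, 1) = s *\<^sub>R p + t *\<^sub>R q"
      by blast
    have "\<exists>a\<ge>0. \<exists>b\<ge>0. v = a *\<^sub>R p + b *\<^sub>R q" if v: "v \<in> K" for v
    proof (cases "fst v \<ge> 0")
      case True
      then obtain a b where "a \<ge> 0" "b \<ge> 0" "v = a *\<^sub>R p + b *\<^sub>R (0, 1)" using p_gen v by blast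
      then show ?thesis
        using st by (intro exI[of _ "a + b * s"] conjI exI[of _ "b * t"]) (auto simp: algebra_simps)
    next
      case False
      then have "fst v \<le> 0" by simp
      then obtain a b where "a \<ge> 0" "b \<ge> 0" "v = a *\<^sub>R q + b *\<^sub>R (0, 1)" using q_gen v by blast
      then show ?thesis
        using st by (intro exI[of _ "b * s"] conjI exI[of _ "a + b * t"]) (auto simp: algebra_simps)
    qed
    then have "K = {a *\<^sub>R p + b *\<^sub>R q | a b. a \<ge> 0 \<and> b \<ge> 0}"
      using add scale p(1) q(1) by blast
    then show ?thesis using st(1) by blast
  qed
qed

lemma planar_coefficients_unique:
  fixes p q :: "real \<times> real"
  assumes "fst p * snd q - snd p * fst q \<noteq> 0" "a *\<^sub>R p + b *\<^sub>R q = a' *\<^sub>R p + b' *\<^sub>R q"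
  shows "a = a'" "b = b'"
proof -
  have e: "(a - a') * fst p + (b - b') * fst q = 0" "(a - a') * snd p + (b - b') * snd q = 0"
    using assms(2) by (auto simp: prod_eq_iff algebra_simps)
  have "(a - a') * (fst p * snd q - snd p * fst q) = 0" "(b - b') * (fst p * snd q - snd p * fst q) = 0"
    using e by algebra+
  then show "a = a'" "b = b'" using assms(1) by auto
qed

text \<open>In the basis \<open>p\<close>, \<open>q\<close> both \<open>T\<close> and its inverse
  have nonnegative entries; such a matrix is diagonal or antidiagonal.\<close>

lemma sector_automorphism:
  fixes T :: "real \<times> real \<Rightarrow> real \<times> real"
  assumes T: "linear T" "surj T" and inv: "\<And>v. T v \<in> K \<longleftrightarrow> v \<in> K"
    and det: "fst p * snd q - snd p * fst q \<noteq> 0"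
    and K: "K = {a *\<^sub>R p + b *\<^sub>R q | a b. a \<ge> 0 \<and> b \<ge> 0}"
  shows "\<exists>l r. T p = l *\<^sub>R p \<and> T q = r *\<^sub>R q \<or> T p = l *\<^sub>R q \<and> T q = r *\<^sub>R p"
proof -
  note un = planar_coefficients_unique[OF det]
  have pK: "p \<in> K" "q \<in> K"
    unfolding K by (auto intro: exI[of _ 1] exI[of _ 0]) (metis add_0 less_eq_real_def scaleR_one scaleR_zero_left zero_less_one add.right_neutral)+
  obtain a b where ab: "a \<ge> 0" "b \<ge> 0" "T p = a *\<^sub>R p + b *\<^sub>R q"
    using inv[of p] pK by (auto simp: K)
  obtain a' b' where ab': "a' \<ge> 0" "b' \<ge> 0" "T q = a' *\<^sub>R p + b' *\<^sub>R q"
    using inv[of q] pK by (auto simp: K)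
  have T_comb: "T (x *\<^sub>R p + y *\<^sub>R q) = (x * a + y * a') *\<^sub>R p + (x * b + y * b') *\<^sub>R q" for x y
    by (simp add: linear_add[OF T(1)] linear_scale[OF T(1)] ab ab' algebra_simps)
  have pre: "\<exists>x\<ge>0. \<exists>y\<ge>0. T (x *\<^sub>R p + y *\<^sub>R q) = v" if "v \<in> K" for v
  proof -
    obtain w where "T w = v" using T(2) by (metis surjD)
    moreover then have "w \<in> K" using inv[of w] that by simp
    ultimately show ?thesis by (auto simp: K)
  qed
  obtain x y where xy: "x \<ge> 0" "y \<ge> 0" "(x * a + y * a') *\<^sub>R p + (x * b + y * b') *\<^sub>R q = 1 *\<^sub>R p + 0 *\<^sub>R q"
    using pre[OF pK(1)] T_comb by auto
  obtain x' y' where xy': "x' \<ge> 0" "y' \<ge> 0" "(x' * a + y' * a') *\<^sub>R p + (x' * b + y' * b') *\<^sub>R q = 0 *\<^sub>R p + 1 *\<^sub>R q"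
    using pre[OF pK(2)] T_comb by auto
  have e: "x * a + y * a' = 1" "x * b + y * b' = 0" using un[OF xy(3)] by auto
  have e': "x' * a + y' * a' = 0" "x' * b + y' * b' = 1" using un[OF xy'(3)] by auto
  have z: "x * b = 0" "y * b' = 0"
    using e(2) xy(1,2) ab(2) ab'(2) by (simp_all add: add_nonneg_eq_0_iff)
  have z': "x' * a = 0" "y' * a' = 0"
    using e'(1) xy'(1,2) ab(1) ab'(1) by (simp_all add: add_nonneg_eq_0_iff)
  have "b = 0 \<and> a' = 0 \<or> a = 0 \<and> b' = 0" using z z' e(1) e'(2) by auto
  then show ?thesis using ab(3) ab'(3) by fastforce
qed

lemma quadratic_three_roots:
  fixes a b c :: real
  assumes "a * x\<^sup>2 + b * x + c = 0" "a * y\<^sup>2 + b * y + c = 0" "a * z\<^sup>2 + b * z + c = 0"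
    and "x \<noteq> y" "y \<noteq> z" "x \<noteq> z"
  shows "a = 0" "c = 0"
proof -
  have "(x - y) * (a * (x + y) + b) = 0" "(x - z) * (a * (x + z) + b) = 0"
    using assms(1,2,3) by algebra+
  then have xy: "a * (x + y) + b = 0" and "a * (x + z) + b = 0" using assms(4,6) by auto
  then have "a * (y - z) = 0" by algebra
  then show "a = 0" using assms(5) by simp
  then show "c = 0" using xy assms(1) by simp
qed

text \<open>\<open>diag(c, m)\<close> after the matrix with rows \<open>(\<alpha>, \<beta>)\<close>
  and \<open>(\<gamma>, \<delta>)\<close>, whose orthogonality is assumed separately.\<close>

definition stretched_rotation :: "real \<Rightarrow> real \<Rightarrow> real \<Rightarrow> real \<Rightarrow> real \<Rightarrow> real \<Rightarrow> real \<times> real \<Rightarrow> real \<times> real" where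
  "stretched_rotation c m \<alpha> \<beta> \<gamma> \<delta> v = (c * (\<alpha> * fst v + \<beta> * snd v), m * (\<gamma> * fst v + \<delta> * snd v))"

text \<open>The rotation preserves the angle between \<open>p\<close> and \<open>q\<close>, hence so does the stretching by
  \<open>c / m\<close> of one coordinate: this is the identity below, cleared of denominators.\<close>

lemma stretched_rotation_edges:
  assumes orth: "\<alpha>\<^sup>2 + \<beta>\<^sup>2 = 1" "\<gamma>\<^sup>2 + \<delta>\<^sup>2 = 1" "\<alpha> * \<gamma> + \<beta> * \<delta> = 0"
    and cm: "c \<noteq> 0" "m \<noteq> 0"
    and det: "p1 * q2 - p2 * q1 \<noteq> 0"
    and edges: "stretched_rotation c m \<alpha> \<beta> \<gamma> \<delta> (p1, p2) = l *\<^sub>R (p1, p2) \<and>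
                stretched_rotation c m \<alpha> \<beta> \<gamma> \<delta> (q1, q2) = r *\<^sub>R (q1, q2) \<or>
                stretched_rotation c m \<alpha> \<beta> \<gamma> \<delta> (p1, p2) = l *\<^sub>R (q1, q2) \<and>
                stretched_rotation c m \<alpha> \<beta> \<gamma> \<delta> (q1, q2) = r *\<^sub>R (p1, p2)"
  shows "(m\<^sup>2 * p1\<^sup>2 + c\<^sup>2 * p2\<^sup>2) * (m\<^sup>2 * q1\<^sup>2 + c\<^sup>2 * q2\<^sup>2) = c\<^sup>2 * m\<^sup>2 * ((p1\<^sup>2 + p2\<^sup>2) * (q1\<^sup>2 + q2\<^sup>2))"
proof -
  have cols: "\<alpha>\<^sup>2 + \<gamma>\<^sup>2 = 1" "\<beta>\<^sup>2 + \<delta>\<^sup>2 = 1" "\<alpha> * \<beta> + \<gamma> * \<delta> = 0" "(\<alpha> * \<delta> - \<beta> * \<gamma>)\<^sup>2 = 1"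
  proof -
    show d: "(\<alpha> * \<delta> - \<beta> * \<gamma>)\<^sup>2 = 1" using orth by algebra
    show "\<alpha>\<^sup>2 + \<gamma>\<^sup>2 = 1" using orth d by algebra
    show "\<beta>\<^sup>2 + \<delta>\<^sup>2 = 1" using orth d by algebra
    show "\<alpha> * \<beta> + \<gamma> * \<delta> = 0" using orth d by algebra
  qed
  \<comment> \<open>Undoing the stretching gives back a vector as long as \<open>x\<close>; the
    factor \<open>c\<^sup>2 * m\<^sup>2\<close> clears the denominators.\<close>
  have len: "s\<^sup>2 * (m\<^sup>2 * y1\<^sup>2 + c\<^sup>2 * y2\<^sup>2) = c\<^sup>2 * m\<^sup>2 * (x1\<^sup>2 + x2\<^sup>2)"
    if "c * (\<alpha> * x1 + \<beta> * x2) = s * y1" "m * (\<gamma> * x1 + \<delta> * x2) = s * y2" for s x1 x2 y1 y2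
  proof -
    have "s\<^sup>2 * (m\<^sup>2 * y1\<^sup>2 + c\<^sup>2 * y2\<^sup>2) = m\<^sup>2 * (s * y1)\<^sup>2 + c\<^sup>2 * (s * y2)\<^sup>2"
      by (simp add: power_mult_distrib algebra_simps)
    also have "\<dots> = c\<^sup>2 * m\<^sup>2 * ((\<alpha> * x1 + \<beta> * x2)\<^sup>2 + (\<gamma> * x1 + \<delta> * x2)\<^sup>2)"
      unfolding that[symmetric] by algebra
    also have "(\<alpha> * x1 + \<beta> * x2)\<^sup>2 + (\<gamma> * x1 + \<delta> * x2)\<^sup>2 = x1\<^sup>2 + x2\<^sup>2"
      using cols(1,2,3) by algebra
    finally show ?thesis .
  qed
  define P where "P = m\<^sup>2 * p1\<^sup>2 + c\<^sup>2 * p2\<^sup>2"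
  define Q where "Q = m\<^sup>2 * q1\<^sup>2 + c\<^sup>2 * q2\<^sup>2"
  define e where "e = \<alpha> * \<delta> - \<beta> * \<gamma>"
  define D where "D = p1 * q2 - p2 * q1"
  have e2: "e\<^sup>2 = 1" using cols(4) by (simp add: e_def)
  have main: "(l * r)\<^sup>2 = c\<^sup>2 * m\<^sup>2 \<and>
      (l * r)\<^sup>2 * (P * Q) = (c\<^sup>2 * m\<^sup>2 * (p1\<^sup>2 + p2\<^sup>2)) * (c\<^sup>2 * m\<^sup>2 * (q1\<^sup>2 + q2\<^sup>2))"
    using edges
  proof
    assume "stretched_rotation c m \<alpha> \<beta> \<gamma> \<delta> (p1, p2) = l *\<^sub>R (p1, p2) \<and>
            stretched_rotation c m \<alpha> \<beta> \<gamma> \<delta> (q1, q2) = r *\<^sub>R (q1, q2)"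
    then have h: "c * (\<alpha> * p1 + \<beta> * p2) = l * p1" "m * (\<gamma> * p1 + \<delta> * p2) = l * p2"
      "c * (\<alpha> * q1 + \<beta> * q2) = r * q1" "m * (\<gamma> * q1 + \<delta> * q2) = r * q2"
      by (auto simp: stretched_rotation_def)
    \<comment> \<open>Areas: the images span the old parallelogram scaled by \<open>c * m\<close>,
      up to the sign \<open>e\<close>. This determines \<open>l * r\<close>.\<close>
    have "(l * p1) * (r * q2) - (l * p2) * (r * q1) = c * m * e * D"
      unfolding h[symmetric] e_def D_def by algebra
    then have "(l * r) * D = (c * m * e) * D" by (simp add: D_def algebra_simps)
    then have "l * r = c * m * e" using det by (simp add: D_def)
    then have "(l * r)\<^sup>2 = c\<^sup>2 * m\<^sup>2" using e2 by (simp add: power_mult_distrib)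
    moreover have "(l\<^sup>2 * P) * (r\<^sup>2 * Q) = (c\<^sup>2 * m\<^sup>2 * (p1\<^sup>2 + p2\<^sup>2)) * (c\<^sup>2 * m\<^sup>2 * (q1\<^sup>2 + q2\<^sup>2))"
      using len[OF h(1,2)] len[OF h(3,4)] by (simp add: P_def Q_def)
    ultimately show ?thesis by (simp add: power_mult_distrib mult_ac)
  next
    assume "stretched_rotation c m \<alpha> \<beta> \<gamma> \<delta> (p1, p2) = l *\<^sub>R (q1, q2) \<and>
            stretched_rotation c m \<alpha> \<beta> \<gamma> \<delta> (q1, q2) = r *\<^sub>R (p1, p2)"
    then have h: "c * (\<alpha> * p1 + \<beta> * p2) = l * q1" "m * (\<gamma> * p1 + \<delta> * p2) = l * q2"
      "c * (\<alpha> * q1 + \<beta> * q2) = r * p1" "m * (\<gamma> * q1 + \<delta> * q2) = r * p2"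
      by (auto simp: stretched_rotation_def)
    \<comment> \<open>Exchanging the edges reverses orientation; the sign disappears on
      squaring.\<close>
    have "(l * q1) * (r * p2) - (l * q2) * (r * p1) = c * m * e * D"
      unfolding h[symmetric] e_def D_def by algebra
    then have "(- (l * r)) * D = (c * m * e) * D" by (simp add: D_def algebra_simps)
    then have "- (l * r) = c * m * e" using det mult_right_cancel[of D] unfolding D_def by blast
    then have "(- (l * r))\<^sup>2 = c\<^sup>2 * m\<^sup>2" using e2 by (simp add: power_mult_distrib)
    then have "(l * r)\<^sup>2 = c\<^sup>2 * m\<^sup>2" by simp
    moreover have "(l\<^sup>2 * Q) * (r\<^sup>2 * P) = (c\<^sup>2 * m\<^sup>2 * (p1\<^sup>2 + p2\<^sup>2)) * (c\<^sup>2 * m\<^sup>2 * (q1\<^sup>2 + q2\<^sup>2))"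
      using len[OF h(1,2)] len[OF h(3,4)] by (simp add: P_def Q_def)
    ultimately show ?thesis by (simp add: power_mult_distrib mult_ac)
  qed
  then have "(c\<^sup>2 * m\<^sup>2) * (P * Q) = (c\<^sup>2 * m\<^sup>2 * (p1\<^sup>2 + p2\<^sup>2)) * (c\<^sup>2 * m\<^sup>2 * (q1\<^sup>2 + q2\<^sup>2))"
    by metis
  then have "(c\<^sup>2 * m\<^sup>2) * (P * Q) = (c\<^sup>2 * m\<^sup>2) * (c\<^sup>2 * m\<^sup>2 * ((p1\<^sup>2 + p2\<^sup>2) * (q1\<^sup>2 + q2\<^sup>2)))"
    by algebra
  then show ?thesis using cm by (simp add: P_def Q_def)
qed

text \<open>The identity for the edges is a quadratic equation in \<open>(c / m)\<^sup>2\<close>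
  whose coefficients depend only on the edges. Three distinct ratios make its leading and constant
  coefficients vanish, which puts the edges on the axes. If \<open>K\<close> is a vertical ray, that
  ray is preserved.\<close>

lemma planar_cone_axes:
  fixes K :: "(real \<times> real) set" and c m \<alpha> \<beta> \<gamma> \<delta> :: "nat \<Rightarrow> real"
  assumes K: "closed K" "convex_cone K" "(0, 1) \<in> K"
    and pointed: "\<And>v. v \<in> K \<Longrightarrow> - v \<in> K \<Longrightarrow> v = 0"
    and orth: "\<And>n. (\<alpha> n)\<^sup>2 + (\<beta> n)\<^sup>2 = 1" "\<And>n. (\<gamma> n)\<^sup>2 + (\<delta> n)\<^sup>2 = 1" "\<And>n. \<alpha> n * \<gamma> n + \<beta> n * \<delta> n = 0"
    and cm: "\<And>n. c n > 0" "\<And>n. m n > 0" and ratio: "inj (\<lambda>n. c n / m n)"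
    and inv: "\<And>n v. stretched_rotation (c n) (m n) (\<alpha> n) (\<beta> n) (\<gamma> n) (\<delta> n) v \<in> K \<longleftrightarrow> v \<in> K"
  shows "\<beta> n = 0 \<or> \<delta> n = 0"
proof -
  define T where "T n = stretched_rotation (c n) (m n) (\<alpha> n) (\<beta> n) (\<gamma> n) (\<delta> n)" for n
  have c0: "c n \<noteq> 0" and m0: "m n \<noteq> 0" for n using cm[of n] by auto
  have lin: "linear (T n)" for n
    unfolding T_def stretched_rotation_def by (intro linearI) (auto simp: algebra_simps)
  have det2: "(\<alpha> n * \<delta> n - \<beta> n * \<gamma> n)\<^sup>2 = 1" for n
    using orth[of n] by algebra
  have "inj (T n)" for n
  proof (rule linear_injective_0[OF lin, THEN iffD2], intro allI impI)
    fix v assume "T n v = 0"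
    then have "\<alpha> n * fst v + \<beta> n * snd v = 0" "\<gamma> n * fst v + \<delta> n * snd v = 0"
      using c0 m0 by (auto simp: T_def stretched_rotation_def zero_prod_def)
    then have "(\<alpha> n * \<delta> n - \<beta> n * \<gamma> n) * fst v = 0" "(\<alpha> n * \<delta> n - \<beta> n * \<gamma> n) * snd v = 0"
      by algebra+
    then show "v = 0" using det2[of n] by (auto simp: prod_eq_iff)
  qed
  then have surj: "surj (T n)" for n
    using linear_injective_imp_surjective[OF lin] by blast
  consider (ray) "\<forall>v\<in>K. fst v = 0"
    | (sector) p q where "fst p * snd q - snd p * fst q \<noteq> 0" "K = {a *\<^sub>R p + b *\<^sub>R q | a b. a \<ge> 0 \<and> b \<ge> 0}"
    using planar_cone_cases[OF K pointed] by blast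
  then show ?thesis
  proof cases
    case ray
    have "T n (0, 1) \<in> K" using inv[of n "(0, 1)"] K(3) by (simp add: T_def)
    with ray have "fst (T n (0, 1)) = 0" by blast
    then show ?thesis using c0[of n] by (simp add: T_def stretched_rotation_def)
  next
    case (sector p q)
    obtain p1 p2 q1 q2 where p: "p = (p1, p2)" and q: "q = (q1, q2)" by fastforce
    have det: "p1 * q2 - p2 * q1 \<noteq> 0" using sector(1) by (simp add: p q)
    have edges: "\<exists>l r. T n p = l *\<^sub>R p \<and> T n q = r *\<^sub>R q \<or> T n p = l *\<^sub>R q \<and> T n q = r *\<^sub>R p" for n
      by (rule sector_automorphism[OF lin surj _ sector]) (use inv in \<open>simp add: T_def\<close>)
    define \<kappa> where "\<kappa> n = (c n / m n)\<^sup>2" for n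
    have quad: "(p2\<^sup>2 * q2\<^sup>2) * (\<kappa> n)\<^sup>2 + (p1\<^sup>2 * q2\<^sup>2 + p2\<^sup>2 * q1\<^sup>2 - (p1\<^sup>2 + p2\<^sup>2) * (q1\<^sup>2 + q2\<^sup>2)) * \<kappa> n + p1\<^sup>2 * q1\<^sup>2 = 0" for n
    proof -
      obtain l r where "T n p = l *\<^sub>R p \<and> T n q = r *\<^sub>R q \<or> T n p = l *\<^sub>R q \<and> T n q = r *\<^sub>R p"
        using edges by blast
      from stretched_rotation_edges[OF orth c0 m0 det this[unfolded T_def p q]]
      have "((m n)\<^sup>2 * p1\<^sup>2 + (c n)\<^sup>2 * p2\<^sup>2) * ((m n)\<^sup>2 * q1\<^sup>2 + (c n)\<^sup>2 * q2\<^sup>2) = (c n)\<^sup>2 * (m n)\<^sup>2 * ((p1\<^sup>2 + p2\<^sup>2) * (q1\<^sup>2 + q2\<^sup>2))"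
        .
      moreover have "(c n)\<^sup>2 = \<kappa> n * (m n)\<^sup>2"
        using m0 by (simp add: \<kappa>_def power_divide)
      ultimately have "(m n)\<^sup>2 * (m n)\<^sup>2 * ((p2\<^sup>2 * q2\<^sup>2) * (\<kappa> n)\<^sup>2 + (p1\<^sup>2 * q2\<^sup>2 + p2\<^sup>2 * q1\<^sup>2 - (p1\<^sup>2 + p2\<^sup>2) * (q1\<^sup>2 + q2\<^sup>2)) * \<kappa> n + p1\<^sup>2 * q1\<^sup>2) = 0"
        by algebra
      then show ?thesis using m0 by simp
    qed
    have ne: "\<kappa> i \<noteq> \<kappa> j" if "i \<noteq> j" for i j
    proof
      assume "\<kappa> i = \<kappa> j"
      then have "c i / m i = c j / m j"
        using cm[of i] cm[of j] by (simp add: \<kappa>_def)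
      then show False using injD[OF ratio] that by blast
    qed
    have "p2\<^sup>2 * q2\<^sup>2 = 0" "p1\<^sup>2 * q1\<^sup>2 = 0"
      using quadratic_three_roots[OF quad[of 0] quad[of 1] quad[of 2]] ne by auto
    then have "p1 = 0 \<and> q2 = 0 \<or> p2 = 0 \<and> q1 = 0" using det by auto
    then show ?thesis
      using edges[of n] det c0[of n] m0[of n] by (auto simp: T_def p q stretched_rotation_def)
  qed
qed

section \<open>Graphs invariant under a slanted translation\<close>

lemma inner_real2: "x \<bullet> y = x $ 1 * y $ 1 + x $ 2 * y $ 2" for x y :: "real ^ 2"
  by (simp add: inner_vec_def sum_2)

lemma obtain_unit_normal_real2:
  fixes u :: "real ^ 2"
  assumes "u \<noteq> 0"
  obtains n where "n \<bullet> n = 1" "n \<bullet> u = 0"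
    "\<And>x. x = (x \<bullet> n) *\<^sub>R n + ((x \<bullet> u) / (norm u)\<^sup>2) *\<^sub>R u"
proof -
  \<comment> \<open>\<open>u\<close> turned by a right angle.\<close>
  define w :: "real ^ 2" where "w = vector [- (u $ 2), u $ 1]"
  define r where "r = norm u"
  have r: "r \<noteq> 0" using assms by (simp add: r_def)
  have r2: "r\<^sup>2 = u $ 1 * u $ 1 + u $ 2 * u $ 2"
    by (simp add: r_def power2_norm_eq_inner inner_real2)
  have exp: "r\<^sup>2 *\<^sub>R x = (x \<bullet> w) *\<^sub>R w + (x \<bullet> u) *\<^sub>R u" for x
    unfolding r2 by (simp add: vec_eq_iff forall_2 inner_real2 w_def algebra_simps)
  have e2: "x = (x \<bullet> ((1 / r) *\<^sub>R w)) *\<^sub>R ((1 / r) *\<^sub>R w) + ((x \<bullet> u) / r\<^sup>2) *\<^sub>R u" for x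
  proof -
    have "x = (1 / r\<^sup>2) *\<^sub>R (r\<^sup>2 *\<^sub>R x)" using r by simp
    also have "\<dots> = (x \<bullet> ((1 / r) *\<^sub>R w)) *\<^sub>R ((1 / r) *\<^sub>R w) + ((x \<bullet> u) / r\<^sup>2) *\<^sub>R u"
      unfolding exp by (simp add: scaleR_add_right power2_eq_square)
    finally show ?thesis .
  qed
  have "((1 / r) *\<^sub>R w) \<bullet> ((1 / r) *\<^sub>R w) = (w \<bullet> w) / r\<^sup>2"
    by (simp add: power2_eq_square)
  also have "w \<bullet> w = r\<^sup>2" by (simp add: inner_real2 w_def r2)
  finally have "((1 / r) *\<^sub>R w) \<bullet> ((1 / r) *\<^sub>R w) = 1"
    using r by (metis divide_self power_not_zero)
  moreover have "((1 / r) *\<^sub>R w) \<bullet> u = 0" by (simp add: inner_real2 w_def)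
  ultimately show thesis using that e2 unfolding r_def by blast
qed

text \<open>Dividing out the line of \<open>(u, 1)\<close> turns the symmetries into stretched
  rotations and the graph into that of a function of one variable. Its growth exponent would be both
  fixed below 1 and arbitrarily close to 1.\<close>

lemma no_slanted_translation:
  fixes f :: "real ^ 2 \<Rightarrow> real" and A :: "nat \<Rightarrow> (real ^ 2) \<times> real \<Rightarrow> (real ^ 2) \<times> real"
  assumes f: "continuous_on UNIV f"
    and u: "u \<noteq> 0" and vK: "(u, 1) \<in> rec_cone f" "- (u, 1) \<in> rec_cone f"
    and lineality: "\<And>v. v \<in> rec_cone f \<Longrightarrow> - v \<in> rec_cone f \<Longrightarrow> \<exists>t. v = t *\<^sub>R (u, 1)"
    and A: "\<And>n. orthogonal_transformation (A n)"
    and c: "\<And>n. c n > 1" "inj c" "filterlim c at_top sequentially"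
    and graph: "\<And>n p. f (fst p) = snd p \<Longrightarrow>
           f (fst (horizontal_scaling (c n) (A n p) + b n)) = snd (horizontal_scaling (c n) (A n p) + b n)"
    and invariant: "\<And>n. (\<forall>v. horizontal_scaling (c n) (A n v) \<in> rec_cone f \<longleftrightarrow> v \<in> rec_cone f) \<or>
                        (\<forall>v. - horizontal_scaling (c n) (A n v) \<in> rec_cone f \<longleftrightarrow> v \<in> rec_cone f)"
  shows False
proof -
  define K where "K = rec_cone f"
  define v where "v = (u, 1 :: real)"
  have add: "p + q \<in> K" if "p \<in> K" "q \<in> K" for p q
    using rec_cone_add that unfolding K_def by blast
  have scale: "t *\<^sub>R p \<in> K" if "p \<in> K" "t \<ge> 0" for p t
    using rec_cone_scaleR that unfolding K_def by blast
  have add_v: "p + t *\<^sub>R v \<in> K" if "p \<in> K" for p t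
  proof (cases "t \<ge> 0")
    case True
    then show ?thesis using add[OF that scale[of v t]] vK by (simp add: K_def v_def)
  next
    case False
    then show ?thesis using add[OF that scale[of "- v" "- t"]] vK by (simp add: K_def v_def)
  qed

  \<comment> \<open>Orthonormal coordinates transverse to the slanted line\<close>
  define r where "r = norm u"
  have r: "r > 0" using u by (simp add: r_def)
  have uu: "u \<bullet> u = r\<^sup>2" by (simp add: r_def power2_norm_eq_inner)
  obtain n0 where n0: "n0 \<bullet> n0 = 1" "n0 \<bullet> u = 0" "\<And>x. x = (x \<bullet> n0) *\<^sub>R n0 + ((x \<bullet> u) / r\<^sup>2) *\<^sub>R u"
    using obtain_unit_normal_real2[OF u] unfolding r_def by metis
  have un0: "u \<bullet> n0 = 0" using n0(2) by (simp add: inner_commute)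
  \<comment> \<open>The length of \<open>(- u, r\<^sup>2)\<close>, which is orthogonal to
    \<open>v\<close> and to \<open>(n0, 0)\<close>.\<close>
  define \<eta> where "\<eta> = sqrt (r\<^sup>2 * (1 + r\<^sup>2))"
  have \<eta>: "\<eta> > 0" using r by (simp add: \<eta>_def add_pos_nonneg)
  have \<eta>2: "\<eta> * \<eta> = r\<^sup>2 * (1 + r\<^sup>2)" by (simp add: \<eta>_def)
  define N where "N = (n0, 0 :: real)"
  define H where "H = (1 / \<eta>) *\<^sub>R (- u, r\<^sup>2)"
  have NN: "N \<bullet> N = 1" by (simp add: N_def n0)
  have HH: "H \<bullet> H = 1"
  proof -
    have "H \<bullet> H = (r\<^sup>2 * (1 + r\<^sup>2)) / (\<eta> * \<eta>)"
      by (simp add: H_def uu algebra_simps add_divide_distrib)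
    then show ?thesis unfolding \<eta>2[symmetric] using \<eta> by simp
  qed
  have NH: "N \<bullet> H = 0" "H \<bullet> N = 0" by (simp_all add: N_def H_def n0 un0)
  have Nv: "N \<bullet> v = 0" "v \<bullet> N = 0" by (simp_all add: N_def v_def n0 un0)
  have Hv: "H \<bullet> v = 0" "v \<bullet> H = 0" by (simp_all add: H_def v_def uu)
  have expand: "p = (p \<bullet> N) *\<^sub>R N + (p \<bullet> H) *\<^sub>R H + ((p \<bullet> v) / (1 + r\<^sup>2)) *\<^sub>R v" for p
  proof -
    obtain x t where p: "p = (x, t)" by fastforce
    have r1: "1 + r\<^sup>2 \<noteq> 0" "r\<^sup>2 \<noteq> 0" using r by (auto simp: add_nonneg_eq_0_iff)
    have pH: "(p \<bullet> H) *\<^sub>R H = ((r\<^sup>2 * t - x \<bullet> u) / (r\<^sup>2 * (1 + r\<^sup>2))) *\<^sub>R (- u, r\<^sup>2)"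
    proof -
      have "(p \<bullet> H) *\<^sub>R H = ((r\<^sup>2 * t - x \<bullet> u) / (\<eta> * \<eta>)) *\<^sub>R (- u, r\<^sup>2)"
        by (simp add: H_def p diff_divide_distrib right_diff_distrib mult_ac)
      then show ?thesis unfolding \<eta>2 .
    qed
    have "x = (x \<bullet> n0) *\<^sub>R n0 + ((x \<bullet> u) / r\<^sup>2) *\<^sub>R u" by (rule n0(3))
    also have "(x \<bullet> u) / r\<^sup>2 = - ((r\<^sup>2 * t - x \<bullet> u) / (r\<^sup>2 * (1 + r\<^sup>2))) + (x \<bullet> u + t) / (1 + r\<^sup>2)"
      using r1 by (simp add: divide_simps) (simp add: algebra_simps)
    finally have fst: "x = (x \<bullet> n0) *\<^sub>R n0 - ((r\<^sup>2 * t - x \<bullet> u) / (r\<^sup>2 * (1 + r\<^sup>2))) *\<^sub>R u + ((x \<bullet> u + t) / (1 + r\<^sup>2)) *\<^sub>R u"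
      by (simp only: scaleR_add_left scaleR_minus_left diff_conv_add_uminus add.assoc)
    have snd: "t = (r\<^sup>2 * t - x \<bullet> u) / (r\<^sup>2 * (1 + r\<^sup>2)) * r\<^sup>2 + (x \<bullet> u + t) / (1 + r\<^sup>2)"
      using r1 by (simp add: divide_simps) (simp add: algebra_simps)
    show ?thesis unfolding pH using fst snd by (simp add: p N_def v_def)
  qed

  \<comment> \<open>The symmetries with their signs removed, and their adjoints\<close>
  define \<epsilon> where "\<epsilon> n = (if \<forall>p. horizontal_scaling (c n) (A n p) \<in> K \<longleftrightarrow> p \<in> K then 1 else -1 :: real)" for n
  define A' where "A' n p = \<epsilon> n *\<^sub>R A n p" for n p
  define L where "L n p = horizontal_scaling (c n) (A' n p)" for n p
  have \<epsilon>: "\<epsilon> n = 1 \<or> \<epsilon> n = -1" for n by (simp add: \<epsilon>_def)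
  have A': "orthogonal_transformation (A' n)" for n
    using \<epsilon>[of n] A[of n] by (auto simp: A'_def[abs_def] orthogonal_transformation_neg)
  note linA' = orthogonal_transformation_linear[OF A']
  have LK: "L n p \<in> K \<longleftrightarrow> p \<in> K" for n p
  proof -
    have neg: "horizontal_scaling t (- v) = - horizontal_scaling t v" for t and v :: "(real ^ 2) \<times> real"
      by (simp add: horizontal_scaling_def)
    show ?thesis
      using invariant[of n] by (simp add: L_def A'_def \<epsilon>_def neg K_def del: split_paired_All split: if_split) blast
  qed
  have L_lin: "L n (t *\<^sub>R p) = t *\<^sub>R L n p" "L n (- p) = - L n p" for n t p
  proof -
    have "linear (L n)"
      using linear_compose[OF linA'[of n] linear_horizontal_scaling[of "c n"]] by (simp add: L_def[abs_def] comp_def)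
    then show "L n (t *\<^sub>R p) = t *\<^sub>R L n p" "L n (- p) = - L n p"
      using linear_scale linear_neg by blast+
  qed
  have orig: "horizontal_scaling (c n) (A n p) = \<epsilon> n *\<^sub>R L n p" for n p
    using \<epsilon>[of n] by (auto simp: L_def A'_def horizontal_scaling_def)
  define B where "B n = inv (A' n)" for n
  have AB: "A' n (B n p) = p" for n p
    using orthogonal_transformation_bij[OF A'[of n]] by (simp add: B_def bij_is_surj surj_f_inv_f)
  have B: "B n p \<bullet> B n q = p \<bullet> q" for n p q
    using orthogonal_transformation_inv[OF A'[of n]]
    by (simp add: B_def orthogonal_transformation_def del: split_paired_All)
  have adj: "A' n p \<bullet> q = p \<bullet> B n q" for n p q
  proof -
    have "A' n p \<bullet> A' n (B n q) = p \<bullet> B n q"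
      using A'[of n] by (simp add: orthogonal_transformation_def del: split_paired_All)
    then show ?thesis by (simp add: AB)
  qed
  have Ladj: "L n p \<bullet> q = p \<bullet> B n (horizontal_scaling (c n) q)" for n p q
    by (simp add: L_def inner_horizontal_scaling adj)
  have Lv: "\<exists>t. L n v = t *\<^sub>R v" for n
  proof -
    have "L n v \<in> K" "- L n v \<in> K"
      using LK[of n v] LK[of n "- v"] vK unfolding L_lin K_def v_def by blast+
    then show ?thesis using lineality[of "L n v"] unfolding K_def v_def by blast
  qed
  \<comment> \<open>As \<open>L n\<close> preserves the line of \<open>v\<close>, its adjoint
    preserves the orthogonal complement.\<close>
  have perp: "B n (horizontal_scaling (c n) q) \<bullet> v = 0" if "q \<bullet> v = 0" for n q
    using Lv[of n] Ladj[of n v q] that by (auto simp: inner_commute)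
  \<comment> \<open>The adjoint of \<open>L n\<close> stretches \<open>H\<close> by
    \<open>m n\<close>, and the horizontal vector \<open>N\<close> by \<open>c n\<close>.\<close>
  define m where "m n = norm (horizontal_scaling (c n) H)" for n
  have c0: "c n > 0" "c n \<noteq> 0" for n using c(1)[of n] by auto
  have m2: "(m n)\<^sup>2 = ((c n)\<^sup>2 + r\<^sup>2) / (1 + r\<^sup>2)" for n
  proof -
    have "(m n)\<^sup>2 = (r\<^sup>2 * ((c n)\<^sup>2 + r\<^sup>2)) / (\<eta> * \<eta>)"
      unfolding m_def power2_norm_eq_inner
      by (simp add: horizontal_scaling_def H_def uu power2_eq_square add_divide_distrib algebra_simps)
    then show ?thesis unfolding \<eta>2 using r by simp
  qed
  have r1: "1 + r\<^sup>2 > 0" by (simp add: add_pos_nonneg)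
  have csq: "(c n)\<^sup>2 > 1" for n using c(1)[of n] by (simp add: one_less_power)
  have m1: "m n > 1" for n
  proof -
    have "(m n)\<^sup>2 > 1\<^sup>2" unfolding m2 using r1 csq[of n] by simp
    then show ?thesis by (rule power2_less_imp_less) (simp add: m_def)
  qed
  have mc: "m n < c n" for n
  proof -
    have "1 * r\<^sup>2 < (c n)\<^sup>2 * r\<^sup>2" using r csq[of n] by (intro mult_strict_right_mono) auto
    then have "(m n)\<^sup>2 < (c n)\<^sup>2" unfolding m2 using r1 by (simp add: divide_less_eq algebra_simps)
    then show ?thesis by (rule power2_less_imp_less) (use c0 in \<open>simp add: less_imp_le\<close>)
  qed
  have m0: "m n > 0" "m n \<noteq> 0" for n using m1[of n] by auto
  have mlow: "m n \<ge> c n / sqrt (1 + r\<^sup>2)" for n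
  proof -
    have "(c n / sqrt (1 + r\<^sup>2))\<^sup>2 \<le> (m n)\<^sup>2"
      unfolding m2 using r1 by (simp add: power_divide divide_right_mono)
    then show ?thesis by (rule power2_le_imp_le) (use m0 in \<open>simp add: less_imp_le\<close>)
  qed
  \<comment> \<open>\<open>(c / m)\<^sup>2\<close> equals
    \<open>(1 + r\<^sup>2) * c\<^sup>2 / (c\<^sup>2 + r\<^sup>2)\<close>, strictly increasing in
    \<open>c\<close> because \<open>r > 0\<close>.\<close>
  have ratio: "inj (\<lambda>n. c n / m n)"
  proof (rule injI)
    fix i j assume eq: "c i / m i = c j / m j"
    then have "(c i)\<^sup>2 / (m i)\<^sup>2 = (c j)\<^sup>2 / (m j)\<^sup>2" by (metis power_divide)
    then have "(c i)\<^sup>2 * (m j)\<^sup>2 = (c j)\<^sup>2 * (m i)\<^sup>2" using m0 by (simp add: frac_eq_eq)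
    then have "(c i)\<^sup>2 * ((c j)\<^sup>2 + r\<^sup>2) = (c j)\<^sup>2 * ((c i)\<^sup>2 + r\<^sup>2)"
      unfolding m2 using r1 by simp
    then have "r\<^sup>2 * (c i)\<^sup>2 = r\<^sup>2 * (c j)\<^sup>2" by (simp add: algebra_simps)
    then have "c i = c j" using r c0(1)[of i] c0(1)[of j] by simp
    then show "i = j" using c(2) by (simp add: inj_eq)
  qed
  \<comment> \<open>Unit vectors along the adjoint images of \<open>N\<close> and \<open>H\<close>,
    orthogonal because the stretched \<open>H\<close> is still orthogonal to \<open>N\<close>. Their
    coordinates are the rows of the rotation.\<close>
  define a where "a n = B n N" for n
  define d where "d n = (1 / m n) *\<^sub>R B n (horizontal_scaling (c n) H)" for n
  have scN: "horizontal_scaling (c n) N = c n *\<^sub>R N" for n by (simp add: horizontal_scaling_def N_def)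
  have linB: "linear (B n)" for n
    unfolding B_def by (intro orthogonal_transformation_linear orthogonal_transformation_inv A')
  have Ba: "B n (horizontal_scaling (c n) N) = c n *\<^sub>R a n" for n
    by (simp add: scN a_def linear_scale[OF linB])
  have Bd: "B n (horizontal_scaling (c n) H) = m n *\<^sub>R d n" for n
    using m0[of n] by (simp add: d_def)
  have av: "a n \<bullet> v = 0" for n using perp[OF Nv(1), of n] c0[of n] by (simp add: Ba)
  have dv: "d n \<bullet> v = 0" for n using perp[OF Hv(1), of n] by (simp add: d_def)
  have aa: "a n \<bullet> a n = 1" for n by (simp add: a_def B NN)
  have dd: "d n \<bullet> d n = 1" for n
  proof -
    have "d n \<bullet> d n = (horizontal_scaling (c n) H \<bullet> horizontal_scaling (c n) H) / (m n)\<^sup>2"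
      by (simp add: d_def B power2_eq_square)
    also have "\<dots> = (m n)\<^sup>2 / (m n)\<^sup>2" by (simp add: m_def power2_norm_eq_inner)
    finally show ?thesis using m0 by simp
  qed
  have ad: "a n \<bullet> d n = 0" for n
  proof -
    have "a n \<bullet> d n = (N \<bullet> horizontal_scaling (c n) H) / m n" by (simp add: a_def d_def B)
    also have "N \<bullet> horizontal_scaling (c n) H = 0" by (simp add: N_def horizontal_scaling_def H_def n0)
    finally show ?thesis by simp
  qed
  define \<alpha> \<beta> \<gamma> \<delta> where "\<alpha> n = a n \<bullet> N" and "\<beta> n = a n \<bullet> H" and "\<gamma> n = d n \<bullet> N" and "\<delta> n = d n \<bullet> H" for n
  have a_exp: "a n = \<alpha> n *\<^sub>R N + \<beta> n *\<^sub>R H" for n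
    using expand[of "a n"] by (simp add: av \<alpha>_def \<beta>_def)
  have d_exp: "d n = \<gamma> n *\<^sub>R N + \<delta> n *\<^sub>R H" for n
    using expand[of "d n"] by (simp add: dv \<gamma>_def \<delta>_def)
  have orth: "(\<alpha> n)\<^sup>2 + (\<beta> n)\<^sup>2 = 1" "(\<gamma> n)\<^sup>2 + (\<delta> n)\<^sup>2 = 1" "\<alpha> n * \<gamma> n + \<beta> n * \<delta> n = 0" for n
  proof -
    have ex: "(s *\<^sub>R N + t *\<^sub>R H) \<bullet> (s' *\<^sub>R N + t' *\<^sub>R H) = s * s' + t * t'" for s t s' t'
      by (simp add: inner_add_left inner_add_right NN HH NH)
    show "(\<alpha> n)\<^sup>2 + (\<beta> n)\<^sup>2 = 1" using aa[of n] unfolding a_exp ex by (simp add: power2_eq_square)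
    show "(\<gamma> n)\<^sup>2 + (\<delta> n)\<^sup>2 = 1" using dd[of n] unfolding d_exp ex by (simp add: power2_eq_square)
    show "\<alpha> n * \<gamma> n + \<beta> n * \<delta> n = 0" using ad[of n] unfolding a_exp d_exp ex .
  qed

  \<comment> \<open>The quotient cone in the plane\<close>
  define \<pi> where "\<pi> p = (p \<bullet> N, p \<bullet> H)" for p
  define T where "T n = stretched_rotation (c n) (m n) (\<alpha> n) (\<beta> n) (\<gamma> n) (\<delta> n)" for n
  have \<pi>L: "\<pi> (L n p) = T n (\<pi> p)" for n p
    unfolding \<pi>_def Ladj Ba Bd T_def stretched_rotation_def
    by (simp add: a_exp d_exp inner_add_right)
  \<comment> \<open>A section of \<open>\<pi>\<close>: it changes points of space only along
    \<open>v\<close>, under which \<open>K\<close> is stable.\<close>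
  define \<iota> where "\<iota> q = fst q *\<^sub>R N + snd q *\<^sub>R H" for q :: "real \<times> real"
  have \<pi>\<iota>: "\<pi> (\<iota> q) = q" for q
    by (simp add: \<pi>_def \<iota>_def inner_add_left NN HH NH)
  have \<iota>\<pi>: "\<exists>t. \<iota> (\<pi> p) = p + t *\<^sub>R v" for p
    using expand[of p] by (intro exI[of _ "- ((p \<bullet> v) / (1 + r\<^sup>2))"]) (simp add: \<iota>_def \<pi>_def algebra_simps)
  have K_mod: "\<iota> (\<pi> p) \<in> K \<longleftrightarrow> p \<in> K" for p
  proof -
    obtain t where t: "\<iota> (\<pi> p) = p + t *\<^sub>R v" using \<iota>\<pi> by blast
    show ?thesis using add_v[of p t] add_v[of "\<iota> (\<pi> p)" "- t"] by (auto simp: t)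
  qed
  define K1 where "K1 = \<iota> -` K"
  have lin\<iota>: "linear \<iota>" unfolding \<iota>_def by (intro linearI) (auto simp: algebra_simps)
  have K1: "closed K1" "convex_cone K1"
  proof -
    show "closed K1" unfolding K1_def \<iota>_def K_def
      by (intro closed_vimage closed_rec_cone f continuous_intros)
    show "convex_cone K1"
      using convex_cone_rec_cone[of f] unfolding K1_def K_def
      by (simp add: convex_cone_iff linear_0[OF lin\<iota>] linear_add[OF lin\<iota>] linear_scale[OF lin\<iota>])
  qed
  have K1e: "(0, 1) \<in> K1"
  proof -
    have "(1 / \<eta>) *\<^sub>R ((1 + r\<^sup>2) *\<^sub>R (0, 1) + (-1) *\<^sub>R v) \<in> K"
      using \<eta> r1 vertical_in_rec_cone[of f] by (intro scale add_v) (auto simp: K_def)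
    moreover have "(1 + r\<^sup>2) *\<^sub>R (0, 1) + (-1) *\<^sub>R v = (- u, r\<^sup>2)" by (simp add: v_def)
    ultimately show ?thesis by (simp add: K1_def \<iota>_def H_def)
  qed
  have K1p: "q = 0" if "q \<in> K1" "- q \<in> K1" for q
  proof -
    have "\<exists>t. \<iota> q = t *\<^sub>R v"
      using that lineality[of "\<iota> q"] by (simp add: K1_def K_def v_def linear_neg[OF lin\<iota>])
    then obtain t where "\<iota> q = t *\<^sub>R v" by blast
    then have "\<pi> (\<iota> q) = 0" by (simp add: \<pi>_def Nv Hv zero_prod_def)
    then show ?thesis by (simp add: \<pi>\<iota>)
  qed
  have K1inv: "T n q \<in> K1 \<longleftrightarrow> q \<in> K1" for n q
  proof -
    have "T n q = \<pi> (L n (\<iota> q))" by (simp add: \<pi>L \<pi>\<iota>)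
    then show ?thesis using LK K_mod by (simp add: K1_def)
  qed
  have axes: "\<beta> n = 0 \<or> \<delta> n = 0" for n
    by (rule planar_cone_axes[OF K1 K1e K1p orth c0(1) m0(1) ratio]) (use K1inv in \<open>auto simp: T_def\<close>)

  \<comment> \<open>The function of one variable and its functional equations\<close>
  define g where "g y = f (y *\<^sub>R n0)" for y
  have f_g: "f x = g (x \<bullet> n0) + (x \<bullet> u) / r\<^sup>2" for x
    using rec_cone_lineality[OF vK, of "(x \<bullet> n0) *\<^sub>R n0" "(x \<bullet> u) / r\<^sup>2"] n0(3)[of x, symmetric]
    by (simp add: g_def)
  have g: "continuous_on UNIV g"
    unfolding g_def by (intro continuous_on_compose2[OF f] continuous_intros) auto
  \<comment> \<open>Otherwise \<open>f\<close> would be invariant along \<open>n0\<close>, and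
    \<open>(n0, 0)\<close> would be a lineality direction off the line of \<open>v\<close>.\<close>
  have "\<exists>y z. g y \<noteq> g z"
  proof (rule ccontr)
    assume const: "\<not> (\<exists>y z. g y \<noteq> g z)"
    have "f (x + t *\<^sub>R (s *\<^sub>R n0)) = f x" for x t s
    proof -
      have "g (x \<bullet> n0 + t * s) = g (x \<bullet> n0)" using const by blast
      then show ?thesis by (simp add: f_g inner_add_left n0)
    qed
    then have "(s *\<^sub>R n0, 0) \<in> rec_cone f" for s by (simp add: rec_cone_def)
    from this[of 1] this[of "-1"] obtain t where "(n0, 0) = t *\<^sub>R (u, 1 :: real)"
      using lineality[of "(n0, 0)"] by auto
    then show False using n0(1) by auto
  qed
  then obtain y z where yz: "g y \<noteq> g z" by blast
  \<comment> \<open>The factor from the value of \<open>g\<close> to the \<open>H\<close> coordinate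
    of a graph point.\<close>
  define \<zeta> where "\<zeta> = r\<^sup>2 / \<eta>"
  have \<zeta>: "\<zeta> \<noteq> 0" using r \<eta> by (simp add: \<zeta>_def)
  have graph_\<pi>: "p \<bullet> H = \<zeta> * g (p \<bullet> N)" if "f (fst p) = snd p" for p
  proof -
    obtain x t where p: "p = (x, t)" by fastforce
    have "t = g (x \<bullet> n0) + (x \<bullet> u) / r\<^sup>2" using that f_g[of x] by (simp add: p)
    then have "r\<^sup>2 * t - x \<bullet> u = r\<^sup>2 * g (x \<bullet> n0)" using r by (simp add: algebra_simps)
    moreover have "p \<bullet> H = (r\<^sup>2 * t - x \<bullet> u) / \<eta>"
      by (simp add: p H_def diff_divide_distrib mult.commute)
    ultimately show ?thesis by (simp add: p N_def \<zeta>_def)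
  qed
  define k l where "k n = b n \<bullet> N" and "l n = b n \<bullet> H" for n
  have g_eq: "g (\<epsilon> n * (c n * (\<alpha> n * y + \<beta> n * (\<zeta> * g y))) + k n) = (\<epsilon> n * (m n * (\<gamma> n * y + \<delta> n * (\<zeta> * g y))) + l n) / \<zeta>" for n y
  proof -
    define p where "p = (y *\<^sub>R n0, g y)"
    have pG: "f (fst p) = snd p" by (simp add: p_def g_def)
    have \<pi>p: "\<pi> p = (y, \<zeta> * g y)"
      using graph_\<pi>[OF pG] by (simp add: \<pi>_def p_def N_def n0)
    define q where "q = horizontal_scaling (c n) (A n p) + b n"
    have q: "q \<bullet> H = \<zeta> * g (q \<bullet> N)" unfolding q_def by (rule graph_\<pi>[OF graph[OF pG]])
    have "\<pi> (L n p) = T n (y, \<zeta> * g y)" by (simp add: \<pi>L \<pi>p)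
    then have "L n p \<bullet> N = c n * (\<alpha> n * y + \<beta> n * (\<zeta> * g y))" "L n p \<bullet> H = m n * (\<gamma> n * y + \<delta> n * (\<zeta> * g y))"
      by (auto simp: \<pi>_def T_def stretched_rotation_def)
    then have "q \<bullet> N = \<epsilon> n * (c n * (\<alpha> n * y + \<beta> n * (\<zeta> * g y))) + k n"
       "q \<bullet> H = \<epsilon> n * (m n * (\<gamma> n * y + \<delta> n * (\<zeta> * g y))) + l n"
      by (auto simp: q_def orig inner_add_left k_def l_def)
    then show ?thesis using q \<zeta> by (simp add: field_simps)
  qed
  have abs\<epsilon>: "\<bar>\<epsilon> n\<bar> = 1" for n using \<epsilon>[of n] by auto
  have abs1: "\<bar>x\<bar> = 1" if "x\<^sup>2 = 1" for x :: real using that by (simp add: abs_square_eq_1)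
  have diagonal: "\<exists>\<sigma> k \<tau> l. \<bar>\<sigma>\<bar> = c n \<and> \<bar>\<tau>\<bar> = m n \<and> (\<forall>y. g (\<sigma> * y + k) = \<tau> * g y + l)" if "\<beta> n = 0" for n
  proof -
    have al: "\<bar>\<alpha> n\<bar> = 1" using orth(1)[of n] that by (intro abs1) simp
    then have ga: "\<gamma> n = 0" using orth(3)[of n] that by auto
    then have de: "\<bar>\<delta> n\<bar> = 1" using orth(2)[of n] by (intro abs1) simp
    have "g ((\<epsilon> n * c n * \<alpha> n) * y + k n) = (\<epsilon> n * m n * \<delta> n) * g y + l n / \<zeta>" for y
      using g_eq[of n y] \<zeta> by (simp add: that ga add_divide_distrib mult.assoc)
    moreover have "\<bar>\<epsilon> n * c n * \<alpha> n\<bar> = c n" "\<bar>\<epsilon> n * m n * \<delta> n\<bar> = m n"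
      using abs\<epsilon> al de c0(1)[of n] m0(1)[of n] by (auto simp: abs_mult)
    ultimately show ?thesis by blast
  qed
  \<comment> \<open>A single antidiagonal map exchanges argument and value and gives no scaling law;
    a composite of two does.\<close>
  have antidiagonal: "\<exists>\<sigma> k \<tau> l. \<bar>\<sigma>\<bar> = c n * m j \<and> \<bar>\<tau>\<bar> = m n * c j \<and> (\<forall>y. g (\<sigma> * y + k) = \<tau> * g y + l)"
    if "\<delta> n = 0" "\<delta> j = 0" for n j
  proof -
    have "\<bar>\<gamma> i\<bar> = 1 \<and> \<alpha> i = 0 \<and> \<bar>\<beta> i\<bar> = 1" if "\<delta> i = 0" for i
    proof -
      have ga: "\<bar>\<gamma> i\<bar> = 1" using orth(2)[of i] that by (intro abs1) simp
      then have al: "\<alpha> i = 0" using orth(3)[of i] that by auto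
      then show ?thesis using ga orth(1)[of i] abs1[of "\<beta> i"] by simp
    qed
    then have n: "\<bar>\<gamma> n\<bar> = 1" "\<alpha> n = 0" "\<bar>\<beta> n\<bar> = 1" and j: "\<bar>\<gamma> j\<bar> = 1" "\<alpha> j = 0" "\<bar>\<beta> j\<bar> = 1"
      using that by auto
    have "g ((\<epsilon> n * c n * \<beta> n * \<epsilon> j * m j * \<gamma> j) * y + (\<epsilon> n * c n * \<beta> n * l j + k n)) =
          (\<epsilon> n * m n * \<gamma> n * \<epsilon> j * c j * \<beta> j) * g y + (\<epsilon> n * m n * \<gamma> n * k j + l n) / \<zeta>" for y
    proof -
      define z where "z = \<epsilon> j * (c j * (\<beta> j * (\<zeta> * g y))) + k j"
      have gz: "\<zeta> * g z = \<epsilon> j * (m j * (\<gamma> j * y)) + l j"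
        using g_eq[of j y] \<zeta> by (simp add: z_def that j)
      have "g (\<epsilon> n * (c n * (\<beta> n * (\<zeta> * g z))) + k n) = (\<epsilon> n * (m n * (\<gamma> n * z)) + l n) / \<zeta>"
        using g_eq[of n z] by (simp add: that n)
      then show ?thesis
        unfolding gz using \<zeta> by (simp add: z_def algebra_simps add_divide_distrib)
    qed
    moreover have "\<bar>\<epsilon> n * c n * \<beta> n * \<epsilon> j * m j * \<gamma> j\<bar> = c n * m j" "\<bar>\<epsilon> n * m n * \<gamma> n * \<epsilon> j * c j * \<beta> j\<bar> = m n * c j"
      using abs\<epsilon> n j c0(1)[of n] m0(1)[of n] c0(1)[of j] m0(1)[of j] by (auto simp: abs_mult)
    ultimately show ?thesis by blast
  qed

  \<comment> \<open>Comparison of growth exponents\<close>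
  have exponent: "ln \<tau>1 * ln \<sigma>2 = ln \<tau>2 * ln \<sigma>1"
    if *: "\<exists>\<sigma> k \<tau> l. \<bar>\<sigma>\<bar> = \<sigma>1 \<and> \<bar>\<tau>\<bar> = \<tau>1 \<and> (\<forall>y. g (\<sigma> * y + k) = \<tau> * g y + l)"
       "\<exists>\<sigma> k \<tau> l. \<bar>\<sigma>\<bar> = \<sigma>2 \<and> \<bar>\<tau>\<bar> = \<tau>2 \<and> (\<forall>y. g (\<sigma> * y + k) = \<tau> * g y + l)"
       "\<sigma>1 > 1" "\<tau>1 > 0" "\<sigma>2 > 1" "\<tau>2 > 0" for \<sigma>1 \<sigma>2 \<tau>1 \<tau>2
  proof -
    obtain s1 k1 t1 l1 where 1: "\<bar>s1\<bar> = \<sigma>1" "\<bar>t1\<bar> = \<tau>1" "\<And>y. g (s1 * y + k1) = t1 * g y + l1"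
      using *(1) by blast
    obtain s2 k2 t2 l2 where 2: "\<bar>s2\<bar> = \<sigma>2" "\<bar>t2\<bar> = \<tau>2" "\<And>y. g (s2 * y + k2) = t2 * g y + l2"
      using *(2) by blast
    show ?thesis
      using growth_exponent_unique[of g y z s1 k1 t1 l1 s2 k2 t2 l2, OF g yz 1(3) _ _ 2(3)] 1(1,2) 2(1,2) *(3-)
      by auto
  qed
  \<comment> \<open>The \<open>n\<close>-th map composed with itself scales argument and value
    alike, so the exponent is 1. The composite with the \<open>j\<close>-th then forces equal ratios
    \<open>c / m\<close>.\<close>
  have at_most_one: "n = j" if "\<delta> n = 0" "\<delta> j = 0" for n j
  proof -
    have "ln (m n * c j) * ln (c n * m n) = ln (m n * c n) * ln (c n * m j)"
      by (rule exponent[OF antidiagonal[OF that] antidiagonal[OF that(1) that(1)]])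
        (use c(1) m1 in \<open>auto intro!: less_1_mult mult_pos_pos m0 c0\<close>)
    moreover have "ln (c n * m n) > 0" using c(1) m1 by (intro ln_gt_zero less_1_mult) auto
    ultimately have "ln (m n * c j) = ln (c n * m j)" by (simp add: mult.commute)
    then have "m n * c j = c n * m j"
      using c0(1)[of n] c0(1)[of j] m0(1)[of n] m0(1)[of j] by (subst (asm) ln_inj_iff) auto
    then have "c n / m n = c j / m j" using m0(2)[of n] m0(2)[of j] by (simp add: field_simps)
    then show "n = j" using injD[OF ratio] by blast
  qed
  obtain n1 where n1: "\<And>n. n \<ge> n1 \<Longrightarrow> \<beta> n = 0"
  proof (cases "\<exists>i. \<delta> i = 0")
    case True
    then obtain i where i: "\<delta> i = 0" by blast
    show thesis by (rule that[of "Suc i"]) (use axes at_most_one[OF i] in fastforce)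
  next
    case False
    then show thesis using that[of 0] axes by blast
  qed
  \<comment> \<open>The common growth exponent of the diagonal maps, below 1 because
    \<open>m n1 < c n1\<close>.\<close>
  define s where "s = ln (m n1) / ln (c n1)"
  have lnc: "ln (c n) > 0" for n using c(1)[of n] by simp
  have s: "s < 1"
    using mc[of n1] m0(1)[of n1] lnc[of n1] by (simp add: s_def divide_less_eq)
  \<comment> \<open>\<open>m n\<close> is the power \<open>s\<close> of \<open>c n\<close>, yet at
    least a fixed multiple of \<open>c n\<close>; this bounds \<open>c n\<close>.\<close>
  have bound: "(1 - s) * ln (c n) \<le> ln (sqrt (1 + r\<^sup>2))" if "n \<ge> n1" for n
  proof -
    have "ln (m n) * ln (c n1) = ln (m n1) * ln (c n)"
      by (rule exponent[OF diagonal[OF n1[OF that]] diagonal[OF n1[OF order_refl]]]) (use c(1) m0 in auto)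
    then have "ln (m n) = s * ln (c n)" using lnc[of n1] by (simp add: s_def field_simps)
    moreover have "ln (c n / sqrt (1 + r\<^sup>2)) \<le> ln (m n)"
      using mlow[of n] c0(1)[of n] r1 m0(1)[of n] by (subst ln_le_cancel_iff) auto
    moreover have "ln (c n / sqrt (1 + r\<^sup>2)) = ln (c n) - ln (sqrt (1 + r\<^sup>2))"
      using c0(1)[of n] r1 by (subst ln_div) auto
    ultimately show ?thesis by (simp add: algebra_simps)
  qed
  have "filterlim (\<lambda>n. ln (c n)) at_top sequentially"
    using filterlim_compose[OF ln_at_top c(3)] .
  then have "\<forall>\<^sub>F n in sequentially. ln (sqrt (1 + r\<^sup>2)) / (1 - s) < ln (c n)"
    by (rule filterlim_at_top_dense[THEN iffD1, rule_format])
  then obtain n where "n \<ge> n1" "ln (sqrt (1 + r\<^sup>2)) / (1 - s) < ln (c n)"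
    unfolding eventually_sequentially by (meson max.cobounded1 max.cobounded2)
  then show False using bound[of n] s by (simp add: divide_less_eq mult.commute)
qed

section \<open>Horizontally rigid functions\<close>

lemma isometry_orthogonal:
  fixes \<phi> :: "'a::euclidean_space \<Rightarrow> 'a"
  assumes "isometry \<phi>"
  shows "orthogonal_transformation (\<lambda>p. \<phi> p - \<phi> 0)"
proof -
  have "dist (\<phi> p) (\<phi> q) = dist p q" for p q using assms by (simp add: isometry_def)
  then show ?thesis by (simp add: orthogonal_transformation_isometry dist_norm)
qed

section \<open>Affine functions are rigid\<close>

lemma reflection_exists:
  fixes a b :: "'a::euclidean_space"
  assumes "norm a = norm b"
  obtains T where "orthogonal_transformation T" "T a = b"
proof
  define e where "e = a - b"
  \<comment> \<open>Reflection in the hyperplane orthogonal to \<open>a - b\<close>. If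
    \<open>a = b\<close>, division by zero makes \<open>k\<close> vanish and \<open>T\<close> the
    identity.\<close>
  define k where "k = 2 / (e \<bullet> e)"
  define T where "T p = p - (k * (p \<bullet> e)) *\<^sub>R e" for p
  have ab: "a \<bullet> a = b \<bullet> b" using assms by (simp add: norm_eq)
  have k: "k * k * (e \<bullet> e) = 2 * k" by (simp add: k_def)
  have "linear T"
    unfolding T_def by (intro linearI) (simp_all add: inner_add_left algebra_simps)
  moreover have "T p \<bullet> T q = p \<bullet> q" for p q
  proof -
    have "T p \<bullet> T q = p \<bullet> q - 2 * k * (p \<bullet> e) * (q \<bullet> e) + k * k * (e \<bullet> e) * (p \<bullet> e) * (q \<bullet> e)"
      by (simp add: T_def inner_diff_left inner_diff_right inner_commute[of e p] inner_commute[of e q] algebra_simps)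
    then show ?thesis unfolding k by simp
  qed
  ultimately show "orthogonal_transformation T" by (simp add: orthogonal_transformation_def)
  show "T a = b"
  proof (cases "e = 0")
    case True then show ?thesis by (simp add: T_def e_def)
  next
    case False
    have "2 * (a \<bullet> e) = e \<bullet> e"
      by (simp add: e_def inner_diff_left inner_diff_right inner_commute[of b a] ab)
    then have "k * (a \<bullet> e) = 1" using False by (simp add: k_def)
    then show ?thesis by (simp add: T_def e_def)
  qed
qed

text \<open>Both graphs are hyperplanes through \<open>(0, a)\<close>; an orthogonal map about this
  point matching their unit normals carries one to the other.\<close>

lemma affine_graph_isometric:
  fixes w w' :: "real ^ 'n"
  shows "\<exists>\<phi>. isometry \<phi> \<and> \<phi> ` graph_of (\<lambda>x. a + x \<bullet> w) = graph_of (\<lambda>x. a + x \<bullet> w')"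
proof -
  define N where "N w = (- w, 1 :: real)" for w :: "real ^ 'n"
  define n where "n w = (1 / norm (N w)) *\<^sub>R N w" for w
  define o' where "o' = (0 :: real ^ 'n, a)"
  have N0: "norm (N w) \<noteq> 0" for w by (simp add: N_def zero_prod_def)
  have "norm (n w) = norm (n w')" using N0 by (simp add: n_def)
  then obtain T where T: "orthogonal_transformation T" "T (n w) = n w'"
    using reflection_exists by blast
  have gr: "p \<in> graph_of (\<lambda>x. a + x \<bullet> w) \<longleftrightarrow> (p - o') \<bullet> n w = 0" for p w
  proof -
    have "(p - o') \<bullet> n w = 0 \<longleftrightarrow> (p - o') \<bullet> N w = 0" using N0 by (simp add: n_def)
    also have "\<dots> \<longleftrightarrow> p \<in> graph_of (\<lambda>x. a + x \<bullet> w)"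
      by (cases p) (auto simp: graph_of_def N_def o'_def)
    finally show ?thesis by simp
  qed
  define \<phi> where "\<phi> p = T (p - o') + o'" for p
  have bij: "bij \<phi>"
    using bij_comp[OF bij_comp[OF bij_plus_right[of "- o'"] orthogonal_transformation_bij[OF T(1)]] bij_plus_right[of o']]
    by (simp add: \<phi>_def[abs_def] comp_def)
  have "dist (\<phi> p) (\<phi> q) = dist p q" for p q
    using orthogonal_transformation_norm[OF T(1), of "p - q"]
    by (simp add: \<phi>_def dist_norm linear_diff[OF orthogonal_transformation_linear[OF T(1)], symmetric])
  then have "isometry \<phi>" using bij by (simp add: isometry_def)
  moreover have mem: "\<phi> p \<in> graph_of (\<lambda>x. a + x \<bullet> w') \<longleftrightarrow> p \<in> graph_of (\<lambda>x. a + x \<bullet> w)" for p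
  proof -
    have "T (p - o') \<bullet> T (n w) = (p - o') \<bullet> n w"
      using T(1) by (simp add: orthogonal_transformation_def del: split_paired_All)
    then show ?thesis unfolding gr by (simp add: \<phi>_def T(2))
  qed
  have "\<phi> ` graph_of (\<lambda>x. a + x \<bullet> w) = graph_of (\<lambda>x. a + x \<bullet> w')"
  proof
    show "graph_of (\<lambda>x. a + x \<bullet> w') \<subseteq> \<phi> ` graph_of (\<lambda>x. a + x \<bullet> w)"
    proof
      fix q assume q: "q \<in> graph_of (\<lambda>x. a + x \<bullet> w')"
      obtain p where "q = \<phi> p" using bij_is_surj[OF bij] by (rule surjE)
      then show "q \<in> \<phi> ` graph_of (\<lambda>x. a + x \<bullet> w)" using q mem by blast
    qed
  qed (use mem in blast)
  ultimately show ?thesis by blast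
qed

lemma horizontally_rigid_affine:
  fixes w :: "real ^ 'n"
  shows "horizontally_rigid (\<lambda>x. a + x \<bullet> w) C"
  unfolding horizontally_rigid_def
proof
  fix c
  have eq: "(\<lambda>x. a + (c *\<^sub>R x) \<bullet> w) = (\<lambda>x. a + x \<bullet> (c *\<^sub>R w))" by simp
  show "\<exists>\<phi>. isometry \<phi> \<and> \<phi> ` graph_of (\<lambda>x. a + x \<bullet> w) = graph_of (\<lambda>x. a + (c *\<^sub>R x) \<bullet> w)"
    unfolding eq by (rule affine_graph_isometric)
qed

section \<open>Functions with symmetric graphs are affine\<close>

text \<open>If \<open>A\<close> and \<open>A'\<close> send the same line to the vertical axis, then composing one affine symmetry
  of the graph with the inverse of the other gives a symmetry acting horizontally by a similarity
  and vertically by \<open>\<plusminus>1\<close>.\<close>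

lemma constant_if_same_axis:
  fixes f :: "'a::euclidean_space \<Rightarrow> real" and A A' :: "'a \<times> real \<Rightarrow> 'a \<times> real"
  assumes f: "continuous_on UNIV f"
    and A: "orthogonal_transformation A" "orthogonal_transformation A'"
    and graph: "\<And>p. f (fst (horizontal_scaling c (A p) + b)) = snd (horizontal_scaling c (A p) + b) \<longleftrightarrow> f (fst p) = snd p"
      "\<And>p. f (fst (horizontal_scaling c' (A' p) + b')) = snd (horizontal_scaling c' (A' p) + b') \<longleftrightarrow> f (fst p) = snd p"
    and c: "0 < c" "c < c'"
    and axis: "A (inv A' (0, 1)) = (0, s)" "\<bar>s\<bar> = 1"
  shows "f x = f y"
proof -
  define B where "B = inv A'"
  have B: "A' (B p) = p" for p
    using orthogonal_transformation_bij[OF A(2)] by (simp add: B_def bij_is_surj surj_f_inv_f)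
  define R where "R p = A (B p)" for p
  have R: "orthogonal_transformation R"
    using orthogonal_transformation_compose[OF A(1) orthogonal_transformation_inv[OF A(2)]]
    by (simp add: R_def[abs_def] B_def comp_def)
  note linR = orthogonal_transformation_linear[OF R]
  have Re: "R (0, 1) = (0, s)" using axis(1) by (simp add: R_def B_def)
  have s: "s \<noteq> 0" using axis(2) by auto
  \<comment> \<open>\<open>R\<close> preserves the vertical axis, hence also the horizontal
    hyperplane.\<close>
  have snd0: "snd (R (x, 0)) = 0" for x
  proof -
    have "R (x, 0) \<bullet> R (0, 1) = (x, 0) \<bullet> (0, 1 :: real)"
      using R by (simp add: orthogonal_transformation_def del: split_paired_All inner_Pair)
    then have "snd (R (x, 0)) * s = 0" unfolding Re by (simp add: inner_prod_def)
    then show ?thesis using s by simp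
  qed
  have R_split: "R (r *\<^sub>R x, t) = (r *\<^sub>R fst (R (x, 0)), t * s)" for r x t
  proof -
    have "R (r *\<^sub>R x, t) = R (r *\<^sub>R (x, 0) + t *\<^sub>R (0, 1))" by simp
    also have "\<dots> = r *\<^sub>R R (x, 0) + t *\<^sub>R R (0, 1)"
      by (simp only: linear_add[OF linR] linear_scale[OF linR])
    finally show ?thesis using snd0[of x] by (simp add: Re prod_eq_iff)
  qed
  \<comment> \<open>The horizontal part of the first symmetry after the inverse of the second, a
    contraction by \<open>c / c'\<close>.\<close>
  define h where "h x = (c / c') *\<^sub>R fst (R (x - fst b', 0)) + fst b" for x
  have inv: "f (h x) = s * f x + (snd b - s * snd b')" for x
  proof -
    \<comment> \<open>\<open>p\<close> undoes translation and stretching of the second symmetry at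
      the graph point over \<open>x\<close>; \<open>q\<close> undoes its orthogonal part
      too.\<close>
    define p where "p = ((1 / c') *\<^sub>R (x - fst b'), f x - snd b')"
    define q where "q = B p"
    have "horizontal_scaling c' (A' q) + b' = (x, f x)"
      using c by (simp add: q_def B p_def horizontal_scaling_def prod_eq_iff)
    then have "f (fst q) = snd q" using graph(2)[of q] by simp
    then have "f (fst (horizontal_scaling c (A q) + b)) = snd (horizontal_scaling c (A q) + b)" using graph(1) by blast
    moreover have "A q = ((1 / c') *\<^sub>R fst (R (x - fst b', 0)), (f x - snd b') * s)"
      using R_split by (simp add: q_def R_def p_def)
    ultimately show ?thesis by (simp add: horizontal_scaling_def h_def algebra_simps)
  qed
  have "dist (h x) (h y) \<le> c / c' * dist x y" for x y
  proof -
    have "R (x - fst b', 0) - R (y - fst b', 0) = R (x - y, 0)"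
      by (simp add: linear_diff[OF linR, symmetric])
    then have "h x - h y = (c / c') *\<^sub>R fst (R (x - y, 0))"
      by (simp add: h_def scaleR_diff_right[symmetric] fst_diff[symmetric] del: fst_diff)
    moreover have "norm (fst (R (x - y, 0))) \<le> norm (x - y)"
      using norm_fst_le[of "fst (R (x - y, 0))" "snd (R (x - y, 0))"] orthogonal_transformation_norm[OF R, of "(x - y, 0)"]
      by (simp add: norm_Pair)
    ultimately show ?thesis
      using c by (simp add: dist_norm divide_right_mono mult_left_mono)
  qed
  then show ?thesis
    by (rule constant_if_contraction_invariant[OF f, rotated 2, OF _ inv axis(2)]) (use c in auto)
qed

text \<open>\<open>u\<close> and \<open>w\<close> form a basis, and Cramer's rule gives the gradient
  \<open>v\<close> with slopes \<open>s\<close> and \<open>s'\<close> along them.\<close>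

lemma affine_if_two_translations:
  fixes f :: "real ^ 2 \<Rightarrow> real"
  assumes u: "\<And>x t. f (x + t *\<^sub>R u) = f x + t * s" and w: "\<And>x t. f (x + t *\<^sub>R w) = f x + t * s'"
    and det: "u $ 1 * w $ 2 - u $ 2 * w $ 1 \<noteq> 0"
  shows "\<exists>a v. \<forall>x. f x = a + x \<bullet> v"
proof -
  define D where "D = u $ 1 * w $ 2 - u $ 2 * w $ 1"
  define v :: "real ^ 2" where "v = vector [(s * w $ 2 - s' * u $ 2) / D, (s' * u $ 1 - s * w $ 1) / D]"
  have "f x = f 0 + x \<bullet> v" for x
  proof -
    define p where "p = (x $ 1 * w $ 2 - x $ 2 * w $ 1) / D"
    define q where "q = (x $ 2 * u $ 1 - x $ 1 * u $ 2) / D"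
    have "D *\<^sub>R x = (D * p) *\<^sub>R u + (D * q) *\<^sub>R w"
      using det by (simp add: vec_eq_iff forall_2 p_def q_def D_def[symmetric])
        (simp add: D_def algebra_simps)
    then have "D *\<^sub>R x = D *\<^sub>R (p *\<^sub>R u + q *\<^sub>R w)" by (simp add: scaleR_add_right)
    then have x: "x = 0 + p *\<^sub>R u + q *\<^sub>R w" using det by (simp add: D_def)
    have "f x = f 0 + (p * s + q * s')" by (subst x) (simp only: u w add.assoc[of "f 0"])
    also have "p * s + q * s' = x \<bullet> v"
      using det by (simp add: inner_real2 v_def p_def q_def add_divide_distrib diff_divide_distrib algebra_simps)
    finally show ?thesis .
  qed
  then show ?thesis by blast
qed

text \<open>Splits by the lineality space \<open>V\<close>: horizontal, a slanted line, or
  containing a slanted line and a further direction. Only the last is possible, and there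
  \<open>f\<close> is affine.\<close>

lemma affine_if_symmetric:
  fixes f :: "real ^ 2 \<Rightarrow> real" and A :: "nat \<Rightarrow> (real ^ 2) \<times> real \<Rightarrow> (real ^ 2) \<times> real"
  assumes f: "continuous_on UNIV f"
    and A: "\<And>n. orthogonal_transformation (A n)"
    and c: "\<And>n. c n > 1" "strict_mono c" "filterlim c at_top sequentially"
    and graph: "\<And>n p. f (fst (horizontal_scaling (c n) (A n p) + b n)) = snd (horizontal_scaling (c n) (A n p) + b n)
                  \<longleftrightarrow> f (fst p) = snd p"
  shows "\<exists>a v. \<forall>x. f x = a + x \<bullet> v"
proof (rule ccontr)
  assume non: "\<nexists>a v. \<forall>x. f x = a + x \<bullet> v"
  have c0: "c n > 0" "c n \<noteq> 0" for n using c(1)[of n] by auto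
  have nonconst: "\<not> (\<forall>x y. f x = f y)"
  proof
    assume "\<forall>x y. f x = f y"
    then have "\<forall>x. f x = f 0 + x \<bullet> 0" by (metis add.right_neutral inner_zero_right)
    then show False using non by blast
  qed
  define K where "K = rec_cone f"
  define L where "L n p = horizontal_scaling (c n) (A n p)" for n p
  have linL: "linear (L n)" for n
    using linear_compose[OF orthogonal_transformation_linear[OF A[of n]] linear_horizontal_scaling[of "c n"]]
    by (simp add: L_def[abs_def] comp_def)
  have bijL: "bij (L n)" for n
  proof -
    have "bij (horizontal_scaling (c n) :: (real ^ 2) \<times> real \<Rightarrow> _)"
      by (rule o_bij[of "horizontal_scaling (1 / c n)"]) (use c0[of n] in \<open>auto simp: comp_def\<close>)
    then show ?thesis
      using bij_comp[OF orthogonal_transformation_bij[OF A[of n]]] by (simp add: L_def[abs_def] comp_def)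
  qed
  have invariant: "(\<forall>v. L n v \<in> K \<longleftrightarrow> v \<in> K) \<or> (\<forall>v. - L n v \<in> K \<longleftrightarrow> v \<in> K)" for n
    unfolding K_def by (rule rec_cone_affine_invariant[OF f linL bijL]) (use graph in \<open>simp add: L_def\<close>)
  have add: "p + q \<in> K" if "p \<in> K" "q \<in> K" for p q
    using rec_cone_add that unfolding K_def by blast
  have scale: "t *\<^sub>R p \<in> K" if "p \<in> K" "t \<ge> 0" for p t
    using rec_cone_scaleR that unfolding K_def by blast
  define V where "V = {v. v \<in> K \<and> - v \<in> K}"
  have V_scale: "t *\<^sub>R p \<in> V" if "p \<in> V" for p t
    using that scale[of p t] scale[of "- p" t] scale[of p "- t"] scale[of "- p" "- t"]
    by (cases "t \<ge> 0") (auto simp: V_def)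
  have V_diff: "p - q \<in> V" if "p \<in> V" "q \<in> V" for p q
    using that add[of p "- q"] add[of "- p" q] by (auto simp: V_def)
  have V_f: "f (x + t *\<^sub>R fst p) = f x + t * snd p" if "p \<in> V" for p x t
    using rec_cone_lineality that unfolding V_def K_def by blast
  have V_vertical: "(0, t) \<in> V \<Longrightarrow> t = 0" for t
    using V_f[of "(0, t)" 0 1] by simp
  \<comment> \<open>A common axis would make \<open>f\<close> constant. The smaller factor must come
    first, so for \<open>j < i\<close> the axis condition is transferred to the inverse
    composite.\<close>
  have distinct: "A i (inv (A j) (0, 1)) \<notin> {(0, 1), (0, -1)}" if "i \<noteq> j" for i j
  proof
    assume "A i (inv (A j) (0, 1)) \<in> {(0, 1), (0, -1)}"
    then obtain s where s: "A i (inv (A j) (0, 1)) = (0, s)" "\<bar>s\<bar> = 1" by fastforce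
    show False
    proof (cases "i < j")
      case True
      then have "f x = f y" for x y
        using constant_if_same_axis[OF f A A graph graph c0(1) _ s] c(2) by (blast dest: strict_monoD)
      then show False using nonconst by blast
    next
      case False
      define w where "w = inv (A j) (0, 1)"
      have w: "A j w = (0, 1)" "A i w = (0, s)"
        using s(1) orthogonal_transformation_bij[OF A[of j]]
        by (auto simp: w_def bij_is_surj surj_f_inv_f)
      have "A i (s *\<^sub>R w) = (0, 1)"
        using s(2) w(2) by (simp add: orthogonal_transformation_scaleR[OF A] abs_if split: if_splits)
      then have "inv (A i) (0, 1) = s *\<^sub>R w"
        using orthogonal_transformation_inj[OF A[of i]] by (metis inv_f_f)
      then have s': "A j (inv (A i) (0, 1)) = (0, s)"
        using w(1) by (simp add: orthogonal_transformation_scaleR[OF A])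
      have "j < i" using False that by simp
      then have "f x = f y" for x y
        using constant_if_same_axis[OF f A A graph graph c0(1) _ s' s(2)] c(2) by (blast dest: strict_monoD)
      then show False using nonconst by blast
    qed
  qed
  show False
  proof (cases "\<forall>v\<in>V. snd v = 0")
    case horizontal: True
    define V' where "V' = {p. \<forall>v\<in>V. p \<bullet> v = 0}"
    have LV: "L n v \<in> V \<longleftrightarrow> v \<in> V" for n v
      using invariant[of n] linear_neg[OF linL, of n v] linear_neg[OF linL, of n "- v"]
      unfolding V_def mem_Collect_eq by (metis minus_minus)
    have AV: "L n v = c n *\<^sub>R A n v" if "v \<in> V" for n v
    proof -
      have "snd (L n v) = 0" using LV[of n v] that horizontal by blast
      then show ?thesis by (simp add: L_def horizontal_scaling_def prod_eq_iff)
    qed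
    \<comment> \<open>On the horizontal invariant space \<open>V\<close> the stretching is
      multiplication by \<open>c n\<close>, and stretchings are self-adjoint. Hence
      \<open>L n\<close> preserves orthogonality to \<open>V\<close>.\<close>
    have LV'_inner: "L n p \<bullet> L n v = (c n)\<^sup>2 * (p \<bullet> v)" if "v \<in> V" for n p v
    proof -
      have h: "snd (A n v) = 0" using AV[OF that, of n] LV[of n v] that horizontal c0[of n] by auto
      have "L n p \<bullet> L n v = c n * (horizontal_scaling (c n) (A n p) \<bullet> A n v)"
        using AV[OF that] by (simp add: L_def)
      also have "horizontal_scaling (c n) (A n p) \<bullet> A n v = A n p \<bullet> (c n *\<^sub>R A n v)"
        using AV[OF that, of n] by (simp add: inner_horizontal_scaling L_def)
      also have "A n p \<bullet> (c n *\<^sub>R A n v) = c n * (p \<bullet> v)"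
        using A[of n] by (simp add: orthogonal_transformation_def del: split_paired_All)
      finally show ?thesis by (simp add: power2_eq_square)
    qed
    have LV': "L n p \<in> V' \<longleftrightarrow> p \<in> V'" for n p
    proof -
      have "L n p \<in> V' \<longleftrightarrow> (\<forall>v\<in>V. L n p \<bullet> L n v = 0)"
      proof -
        have "V = L n ` V"
        proof
          show "V \<subseteq> L n ` V" using LV bij_is_surj[OF bijL[of n]] by (metis imageI surjD subsetI)
        qed (use LV in blast)
        then have "(\<forall>v\<in>V. L n p \<bullet> v = 0) \<longleftrightarrow> (\<forall>v\<in>L n ` V. L n p \<bullet> v = 0)" by simp
        then show ?thesis unfolding V'_def by blast
      qed
      also have "\<dots> \<longleftrightarrow> p \<in> V'"
        unfolding V'_def using LV'_inner c0[of n] by auto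
      finally show ?thesis .
    qed
    have V'_neg: "- p \<in> V' \<longleftrightarrow> p \<in> V'" for p by (auto simp: V'_def)
    show False
    \<comment> \<open>Intersecting with \<open>V'\<close> makes the cone pointed and keeps the
      vertical vector, as \<open>V\<close> is horizontal.\<close>
    proof (rule no_pointed_invariant_cone[of "K \<inter> V'" A c])
      have "V' = (\<Inter>v\<in>V. {p. p \<bullet> v = 0})" by (auto simp: V'_def)
      moreover have "closed {p. p \<bullet> v = 0}" for v :: "(real ^ 2) \<times> real"
        by (intro closed_Collect_eq continuous_intros)
      ultimately have "closed V'" by (auto intro!: closed_INT)
      then show "closed (K \<inter> V')" using closed_rec_cone[OF f] by (simp add: K_def closed_Int)
      show "convex_cone (K \<inter> V')"
        using convex_cone_rec_cone[of f] by (auto simp: convex_cone_iff K_def V'_def inner_add_left)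
      show "(0, 1) \<in> K \<inter> V'"
        using horizontal vertical_in_rec_cone[of f] by (auto simp: K_def V'_def inner_prod_def)
      show "v = 0" if "v \<in> K \<inter> V'" "- v \<in> K \<inter> V'" for v
      proof -
        have "v \<in> V" using that by (simp add: V_def)
        then have "v \<bullet> v = 0" using that by (auto simp: V'_def)
        then show ?thesis by simp
      qed
      show "(\<forall>v. horizontal_scaling (c n) (A n v) \<in> K \<inter> V' \<longleftrightarrow> v \<in> K \<inter> V') \<or>
            (\<forall>v. - horizontal_scaling (c n) (A n v) \<in> K \<inter> V' \<longleftrightarrow> v \<in> K \<inter> V')" for n
        using invariant[of n] LV'[of n] V'_neg unfolding L_def[symmetric] by blast
    qed (use A c0 c(3) distinct in auto)
  next
    case False
    then obtain v where v: "v \<in> V" "snd v \<noteq> 0" by blast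
    define u where "u = (1 / snd v) *\<^sub>R fst v"
    have uV: "(u, 1) \<in> V"
      using V_scale[OF v(1), of "1 / snd v"] v(2) by (cases v) (simp add: u_def)
    have u0: "u \<noteq> 0" using V_vertical[of 1] uV by auto
    show False
    proof (cases "\<forall>v\<in>V. \<exists>t. v = t *\<^sub>R (u, 1)")
      case True
      show False
      proof (rule no_slanted_translation[OF f u0 _ _ _ A c(1) strict_mono_imp_inj_on[OF c(2)] c(3)])
        show "(u, 1) \<in> rec_cone f" "- (u, 1) \<in> rec_cone f" using uV by (auto simp: V_def K_def)
        show "\<exists>t. v = t *\<^sub>R (u, 1)" if "v \<in> rec_cone f" "- v \<in> rec_cone f" for v
          using True that unfolding V_def K_def by blast
        show "f (fst (horizontal_scaling (c n) (A n p) + b n)) = snd (horizontal_scaling (c n) (A n p) + b n)"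
          if "f (fst p) = snd p" for n p using that graph by blast
      qed (use invariant in \<open>simp add: L_def K_def\<close>)
    next
      case False
      then obtain v' where v': "v' \<in> V" "\<nexists>t. v' = t *\<^sub>R (u, 1)" by blast
      \<comment> \<open>Subtracting a multiple of \<open>(u, 1)\<close> leaves a horizontal
        direction. If \<open>u\<close> and \<open>w\<close> were dependent, \<open>V\<close> would
        contain a nonzero vertical vector.\<close>
      define w where "w = fst v' - snd v' *\<^sub>R u"
      have wV: "(w, 0) \<in> V"
        using V_diff[OF v'(1) V_scale[OF uV, of "snd v'"]] by (cases v') (simp add: w_def)
      have w0: "w \<noteq> 0"
      proof
        assume "w = 0"
        then have "v' = snd v' *\<^sub>R (u, 1)" by (simp add: w_def prod_eq_iff)
        then show False using v'(2) by blast
      qed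
      have "u $ 1 * w $ 2 - u $ 2 * w $ 1 \<noteq> 0"
      proof
        assume det: "u $ 1 * w $ 2 - u $ 2 * w $ 1 = 0"
        have "\<exists>i. w $ i \<noteq> 0" using w0 by (simp add: vec_eq_iff)
        then obtain i where i: "w $ i \<noteq> 0" by blast
        have "w $ i *\<^sub>R u = u $ i *\<^sub>R w"
          using det exhaust_2[of i] by (auto simp: vec_eq_iff forall_2 algebra_simps)
        moreover have "w $ i *\<^sub>R (u, 1) - u $ i *\<^sub>R (w, 0) \<in> V"
          using V_diff V_scale uV wV by blast
        ultimately have "(0, w $ i) \<in> V" by simp
        then show False using V_vertical i by blast
      qed
      moreover have "f (x + t *\<^sub>R u) = f x + t * 1" "f (x + t *\<^sub>R w) = f x + t * 0" for x t
        using V_f[OF uV] V_f[OF wV] by auto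
      ultimately show False using affine_if_two_translations non by blast
    qed
  qed
qed

section \<open>A sequence of scales and the equivalence\<close>

lemma condensates_to_infinity_sequence:
  assumes "condensates_to_infinity C"
  obtains c where "\<And>n :: nat. c n \<in> C" "\<And>n. c n > 1" "strict_mono c" "filterlim c at_top sequentially"
proof -
  have "\<exists>x\<in>C. r < x" for r
  proof -
    have "C \<inter> {r<..} \<noteq> {}"
      using assms unfolding condensates_to_infinity_def by (metis countable_empty)
    then show ?thesis by auto
  qed
  then obtain pick where pick: "\<And>r. pick r \<in> C" "\<And>r. r < pick r" by metis
  \<comment> \<open>The added 1 makes every step exceed 1, so the sequence tends to
    infinity.\<close>
  define c where "c = rec_nat (pick 1) (\<lambda>_ x. pick (x + 1))"
  have c: "c 0 = pick 1" "c (Suc n) = pick (c n + 1)" for n by (simp_all add: c_def)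
  have step: "c n + 1 < c (Suc n)" for n by (simp add: c pick(2))
  have lower: "c n > 1 + real n" for n
  proof (induction n)
    case (Suc n) then show ?case using step[of n] by simp
  qed (simp add: c pick(2))
  show thesis
  proof
    show "c n \<in> C" for n by (cases n) (simp_all add: c pick(1))
    show "c n > 1" for n using lower[of n] by simp
    show "strict_mono c" unfolding strict_mono_Suc_iff using step by (smt (verit))
    show "filterlim c at_top sequentially"
    proof (rule filterlim_at_top_mono[OF filterlim_real_sequentially always_eventually], rule allI)
      show "real n \<le> c n" for n using lower[of n] by simp
    qed
  qed
qed

theorem theorem1p8:
  fixes C :: "real set" and f :: "real ^ 2 \<Rightarrow> real"
  assumes "C \<subseteq> {0<..}"
    and "condensates_to_infinity C"
    and "continuous_on UNIV f"
  shows "horizontally_rigid f C \<longleftrightarrow>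
    (\<exists>a b d. \<forall>x y. f (vector [x, y]) = a + b * x + d * y)"
proof
  assume rigid: "horizontally_rigid f C"
  obtain c where c: "\<And>n :: nat. c n \<in> C" "\<And>n. c n > 1" "strict_mono c" "filterlim c at_top sequentially"
    using condensates_to_infinity_sequence[OF assms(2)] by metis
  have "\<exists>\<phi>. isometry \<phi> \<and> \<phi> ` graph_of f = graph_of (\<lambda>x. f (c n *\<^sub>R x))" for n
    using rigid c(1) unfolding horizontally_rigid_def by blast
  then obtain \<phi> where \<phi>: "\<And>n. isometry (\<phi> n)" "\<And>n. \<phi> n ` graph_of f = graph_of (\<lambda>x. f (c n *\<^sub>R x))"
    by metis
  have "\<exists>a v. \<forall>x. f x = a + x \<bullet> v"
  proof (rule affine_if_symmetric[OF assms(3) isometry_orthogonal[OF \<phi>(1)] c(2-4)])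
    fix n p
    \<comment> \<open>The isometry splits into its linear part and the translation by
      \<open>\<phi> n 0\<close>, which gets stretched as well.\<close>
    have "horizontal_scaling (c n) (\<phi> n p - \<phi> n 0) + horizontal_scaling (c n) (\<phi> n 0) = horizontal_scaling (c n) (\<phi> n p)"
      by (simp add: linear_diff[OF linear_horizontal_scaling])
    moreover have "f (fst (horizontal_scaling (c n) (\<phi> n p))) = snd (horizontal_scaling (c n) (\<phi> n p)) \<longleftrightarrow> f (fst p) = snd p"
    proof -
      have mem: "q \<in> graph_of g \<longleftrightarrow> g (fst q) = snd q" for q and g :: "real ^ 2 \<Rightarrow> real"
        by (cases q) (auto simp: graph_of_def)
      have "inj (\<phi> n)" using \<phi>(1)[of n] by (simp add: isometry_def bij_is_inj)
      then have "\<phi> n p \<in> \<phi> n ` graph_of f \<longleftrightarrow> p \<in> graph_of f" by (rule inj_image_mem_iff)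
      then show ?thesis unfolding \<phi>(2) mem by (simp add: horizontal_scaling_def)
    qed
    ultimately show "f (fst (horizontal_scaling (c n) (\<phi> n p - \<phi> n 0) + horizontal_scaling (c n) (\<phi> n 0))) =
        snd (horizontal_scaling (c n) (\<phi> n p - \<phi> n 0) + horizontal_scaling (c n) (\<phi> n 0)) \<longleftrightarrow> f (fst p) = snd p"
      by simp
  qed
  then obtain a v where "\<And>x. f x = a + x \<bullet> v" by blast
  then have "\<forall>x y. f (vector [x, y]) = a + v $ 1 * x + v $ 2 * y"
    by (simp add: inner_real2 algebra_simps)
  then show "\<exists>a b d. \<forall>x y. f (vector [x, y]) = a + b * x + d * y" by blast
next
  assume "\<exists>a b d. \<forall>x y. f (vector [x, y]) = a + b * x + d * y"
  then obtain a b d where f: "\<And>x y. f (vector [x, y]) = a + b * x + d * y" by blast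
  have "f = (\<lambda>z. a + z \<bullet> vector [b, d])"
  proof
    fix z :: "real ^ 2"
    have "z = vector [z $ 1, z $ 2]" by (simp add: vec_eq_iff forall_2)
    then have "f z = a + b * z $ 1 + d * z $ 2" using f by metis
    then show "f z = a + z \<bullet> vector [b, d]" by (simp add: inner_real2 algebra_simps)
  qed
  then show "horizontally_rigid f C"
    using horizontally_rigid_affine[of a "vector [b, d]" C] by (simp only:)
qed

end
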